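(* Let the setting be as in the context, with $0<\sigma<\infty$, $f\in L^1(\Omega)$, $g\in C^{0,1}(\partial\Omega)$ with $L\le\sigma$, and assume that there exists $\bar g\in S_g$ with $F(\bar g)<+\infty$. If the minimizer $u$ of $F$ on $S_g$ satisfies $\|\nabla u\|_{L^\infty(\Omega)}<\sigma$, then $u$ is a weak solution of $$-\sum_{p=2}^\infty a_p\Delta_pu=f\ \text{ in }\Omega,\qquad u=g\ \text{ on }\partial\Omega.$$ Conversely, if $u\in S_g$ is a weak solution of this problem and $\int_\Omega\mathbf a(\nabla u)\cdot\nabla(v-u)$ is well defined for every $v\in S_g$ with $F(v)<\infty$, then $u$ is the minimizer of $F$ on $S_g$.
   Context: $\Omega\subset\mathbb{R}^N$ ($N\ge1$) is a bounded, connected, open set with Lipschitz boundary. $\{a_p\}_{p\ge2}$ ($p$ integer) is a real sequence with $a_p\ge0$ for all $p$, $a_2>0$, and $a_p\ne0$ for infinitely many $p$; $\sigma$ is defined by $1/\sigma=\limsup_{p\to\infty}a_p^{1/p}$. Put $\Phi(t)=\sum_{p\ge2}\frac{a_p}{p}t^p\in[0,+\infty]$ for $t\in[0,\sigma]$, and $\mathbf a(\xi)=\sum_{p\ge2}a_p|\xi|^{p-2}\xi$ (convergent for $|\xi|<\sigma$, and also for $|\xi|=\sigma$ when $\sum_pa_p\sigma^{p-1}<\infty$). Put $G(\xi)=\Phi(|\xi|)$ if $|\xi|\le\sigma$ and $G(\xi)=+\infty$ if $|\xi|>\sigma$. For $g\in C^{0,1}(\partial\Omega)$ put $L=\sup_{x\ne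 y\in\partial\Omega}\frac{|g(x)-g(y)|}{|x-y|}$ and $S_g=\{v\in C^{0,1}(\overline\Omega):\ \|\nabla v\|_{L^\infty(\Omega)}\le\sigma,\ v=g\text{ on }\partial\Omega\}$; for $v\in S_g$, $F(v)=\int_\Omega G(\nabla v)-\int_\Omega fv\in(-\infty,+\infty]$. Under the stated assumptions $F$ has a unique minimizer on $S_g$. Here $\Delta_pu=\operatorname{div}(|\nabla u|^{p-2}\nabla u)$. A function $u\in S_g$ is a weak solution of the Dirichlet problem if $\sum_{p=2}^{\infty}a_p\int_\Omega|\nabla u|^{p-2}\nabla u\cdot\nabla\psi=\int_\Omega f\psi$ for every $\psi\in W^{1,\infty}_0(\Omega)$ (Lipschitz functions on $\overline\Omega$ vanishing on $\partial\Omega$) for which the series on the left is absolutely convergent, i.e. $\sum_pa_p\big|\int_\Omega|\nabla u|^{p-2}\nabla u\cdot\nabla\psi\big|<\infty$. *)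

theory Defs
  imports "HOL-Analysis.Analysis" "HOL-Probability.Essential_Supremum"
begin

text \<open>
  Points of the closure of \<open>\<Omega>\<close> are points of the ambient Euclidean space. Functions on the closure
  or on the boundary of \<open>\<Omega>\<close> are total functions of which only the values on that set matter.
\<close>

text \<open>
  Near each boundary point, \<open>\<Omega>\<close> is the strict epigraph of a Lipschitz function over the
  hyperplane orthogonal to some unit vector \<open>e\<close>. In dimension one that hyperplane is \<open>{0}\<close>.
\<close>

definition lipschitz_boundary :: "'a::euclidean_space set \<Rightarrow> bool" where
  "lipschitz_boundary \<Omega> \<longleftrightarrow>
     (\<forall>z\<in>frontier \<Omega>. \<exists>r>0. \<exists>e C \<gamma>. norm e = 1 \<and> lipschitz_on C {y. y \<bullet> e = 0} \<gamma> \<and>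
        \<Omega> \<inter> ball z r = {x \<in> ball z r. \<gamma> (x - (x \<bullet> e) *\<^sub>R e) < x \<bullet> e})"

definition lipschitz_fun :: "'a::metric_space set \<Rightarrow> ('a \<Rightarrow> real) \<Rightarrow> bool" where
  "lipschitz_fun S v \<longleftrightarrow> (\<exists>C. lipschitz_on C S v)"

definition lip_seminorm :: "'a::metric_space set \<Rightarrow> ('a \<Rightarrow> real) \<Rightarrow> real" where
  "lip_seminorm S g = Sup {\<bar>g x - g y\<bar> / dist x y | x y. x \<in> S \<and> y \<in> S \<and> x \<noteq> y}"

text \<open>
  The vector of classical partial derivatives. For a Lipschitz function these exist almost
  everywhere and coincide almost everywhere with the weak ones. On the remaining null set
  \<^const>\<open>deriv\<close> has an arbitrary value.
\<close>

definition grad :: "('a::euclidean_space \<Rightarrow> real) \<Rightarrow> 'a \<Rightarrow> 'a" where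
  "grad v x = (\<Sum>b\<in>Basis. deriv (\<lambda>t. v (x + t *\<^sub>R b)) 0 *\<^sub>R b)"

definition Linf_norm :: "'a::euclidean_space set \<Rightarrow> ('a \<Rightarrow> 'a) \<Rightarrow> ereal" where
  "Linf_norm \<Omega> V = esssup (lebesgue_on \<Omega>) (\<lambda>x. ereal (norm (V x)))"

text \<open>All series over \<open>p \<ge> 2\<close> are indexed by \<open>n = p - 2\<close>.\<close>

definition Phi :: "(nat \<Rightarrow> real) \<Rightarrow> real \<Rightarrow> ennreal" where
  "Phi a t = (\<Sum>n. ennreal (a (n + 2) / real (n + 2) * t ^ (n + 2)))"

definition G :: "(nat \<Rightarrow> real) \<Rightarrow> real \<Rightarrow> 'a::euclidean_space \<Rightarrow> ennreal" where
  "G a \<sigma> \<xi> = (if norm \<xi> \<le> \<sigma> then Phi a (norm \<xi>) else \<infinity>)"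

definition pflux :: "nat \<Rightarrow> 'a::euclidean_space \<Rightarrow> 'a" where
  "pflux p \<xi> = norm \<xi> ^ (p - 2) *\<^sub>R \<xi>"

definition flux_converges :: "(nat \<Rightarrow> real) \<Rightarrow> 'a::euclidean_space \<Rightarrow> bool" where
  "flux_converges a \<xi> \<longleftrightarrow> summable (\<lambda>n. a (n + 2) *\<^sub>R pflux (n + 2) \<xi>)"

definition flux :: "(nat \<Rightarrow> real) \<Rightarrow> 'a::euclidean_space \<Rightarrow> 'a" where
  "flux a \<xi> = (\<Sum>n. a (n + 2) *\<^sub>R pflux (n + 2) \<xi>)"

definition S :: "'a::euclidean_space set \<Rightarrow> real \<Rightarrow> ('a \<Rightarrow> real) \<Rightarrow> ('a \<Rightarrow> real) set" where
  "S \<Omega> \<sigma> g = {v. lipschitz_fun (closure \<Omega>) v \<and> Linf_norm \<Omega> (grad v) \<le> ereal \<sigma> \<and>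
                 (\<forall>x\<in>frontier \<Omega>. v x = g x)}"

definition F :: "(nat \<Rightarrow> real) \<Rightarrow> real \<Rightarrow> 'a::euclidean_space set \<Rightarrow> ('a \<Rightarrow> real) \<Rightarrow> ('a \<Rightarrow> real) \<Rightarrow> ereal" where
  "F a \<sigma> \<Omega> f v =
     enn2ereal (\<integral>\<^sup>+x. G a \<sigma> (grad v x) \<partial>lebesgue_on \<Omega>) - ereal (\<integral>x. f x * v x \<partial>lebesgue_on \<Omega>)"

definition is_minimizer ::
  "(nat \<Rightarrow> real) \<Rightarrow> real \<Rightarrow> 'a::euclidean_space set \<Rightarrow> ('a \<Rightarrow> real) \<Rightarrow> ('a \<Rightarrow> real) \<Rightarrow> ('a \<Rightarrow> real) \<Rightarrow> bool" where
  "is_minimizer a \<sigma> \<Omega> f g u \<longleftrightarrow> u \<in> S \<Omega> \<sigma> g \<and> (\<forall>v\<in>S \<Omega> \<sigma> g. F a \<sigma> \<Omega> f u \<le> F a \<sigma> \<Omega> f v)"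

definition W0_inf :: "'a::euclidean_space set \<Rightarrow> ('a \<Rightarrow> real) set" where
  "W0_inf \<Omega> = {\<psi>. lipschitz_fun (closure \<Omega>) \<psi> \<and> (\<forall>x\<in>frontier \<Omega>. \<psi> x = 0)}"

text \<open>The weak form of \<open>- \<Delta>\<^sub>p u\<close> tested against \<open>\<psi>\<close>.\<close>

definition pLaplace_form :: "nat \<Rightarrow> 'a::euclidean_space set \<Rightarrow> ('a \<Rightarrow> real) \<Rightarrow> ('a \<Rightarrow> real) \<Rightarrow> real" where
  "pLaplace_form p \<Omega> u \<psi> = (\<integral>x. pflux p (grad u x) \<bullet> grad \<psi> x \<partial>lebesgue_on \<Omega>)"

definition weak_solution ::
  "(nat \<Rightarrow> real) \<Rightarrow> real \<Rightarrow> 'a::euclidean_space set \<Rightarrow> ('a \<Rightarrow> real) \<Rightarrow> ('a \<Rightarrow> real) \<Rightarrow> ('a \<Rightarrow> real) \<Rightarrow> bool" where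
  "weak_solution a \<sigma> \<Omega> f g u \<longleftrightarrow> u \<in> S \<Omega> \<sigma> g \<and>
     (\<forall>\<psi>\<in>W0_inf \<Omega>. summable (\<lambda>n. a (n + 2) * \<bar>pLaplace_form (n + 2) \<Omega> u \<psi>\<bar>) \<longrightarrow>
        (\<Sum>n. a (n + 2) * pLaplace_form (n + 2) \<Omega> u \<psi>) = (\<integral>x. f x * \<psi> x \<partial>lebesgue_on \<Omega>))"

text \<open>
  The integral of \<open>flux a (\<nabla>u) \<bullet> \<nabla>\<psi>\<close> is well defined: the series defining the flux converges
  almost everywhere (which can only fail where \<open>|\<nabla>u| = \<sigma>\<close>), and the integrand is Lebesgue integrable.
\<close>

definition flux_integral_well_defined ::
  "(nat \<Rightarrow> real) \<Rightarrow> 'a::euclidean_space set \<Rightarrow> ('a \<Rightarrow> real) \<Rightarrow> ('a \<Rightarrow> real) \<Rightarrow> bool" where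
  "flux_integral_well_defined a \<Omega> u \<psi> \<longleftrightarrow>
     (AE x in lebesgue_on \<Omega>. flux_converges a (grad u x)) \<and>
     integrable (lebesgue_on \<Omega>) (\<lambda>x. flux a (grad u x) \<bullet> grad \<psi> x)"

end

theory Submission
  imports Defs
begin

text \<open>
  Lipschitz functions of one variable are differentiable almost everywhere: after adding a linear
  function they become bi-Lipschitz, and the image of Lebesgue measure under the inverse has a
  density, to which the Lebesgue differentiation theorem applies. Fubini's theorem then gives the
  partial derivatives of Lipschitz functions almost everywhere, so that \<open>grad\<close> is linear almost everywhere.

  Both implications rest on the gradient inequality
  \<open>G \<eta> \<ge> G \<xi> + flux a \<xi> \<bullet> (\<eta> - \<xi>)\<close>. For a weak solution \<open>u\<close> it is integrated with \<open>\<xi> = grad u\<close> and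
  \<open>\<eta> = grad v\<close>. For a minimizer \<open>u\<close> with gradient bounded away from \<open>\<sigma>\<close> it is integrated with
  \<open>\<xi> = grad (u + r \<psi>)\<close> and \<open>\<eta> = grad u\<close>, which gives \<open>r \<integral> f \<psi> \<le> r \<integral> flux a (grad (u + r \<psi>)) \<bullet> grad \<psi>\<close>
  for small \<open>r\<close> of either sign, and \<open>r\<close> tends to \<open>0\<close>.
\<close>

section \<open>Lipschitz functions of one variable\<close>

text \<open>If \<kappa> is the inverse of the bi-Lipschitz \<psi>, the image \<mu> of Lebesgue
  measure under \<kappa> gives \<open>{x..y}\<close> the mass \<open>\<psi> y - \<psi> x\<close>.
  Since \<psi> preserves null sets, \<mu> has a density, so \<psi> is an indefinite integral and
  differentiation of integrals applies.\<close>

lemma lipschitz_real_AE_differentiable: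
  fixes \<phi> :: "real \<Rightarrow> real"
  assumes "C-lipschitz_on UNIV \<phi>"
  shows "negligible {x. \<not> \<phi> field_differentiable (at x)}"
proof -
  have C: "C \<ge> 0" and lip: "\<bar>\<phi> x - \<phi> y\<bar> \<le> C * \<bar>x - y\<bar>" for x y
    using assms by (auto simp: lipschitz_on_def dist_real_def)
  \<comment> \<open>The summand \<open>C + 1\<close> outweighs any decrease of \<phi>: all slopes of
    \<psi> lie between 1 and \<open>2 * C + 1\<close>.\<close>
  define \<psi> where "\<psi> x = (C + 1) * x + \<phi> x" for x
  have low: "y - x \<le> \<psi> y - \<psi> x" and up: "\<psi> y - \<psi> x \<le> (2 * C + 1) * (y - x)" if "x \<le> y" for x y
    using lip[of y x] that by (auto simp: \<psi>_def algebra_simps)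
  have mono: "\<psi> x \<le> \<psi> y \<longleftrightarrow> x \<le> y" for x y
    using low[of x y] low[of y x] by linarith
  have lip\<psi>: "\<bar>\<psi> y - \<psi> x\<bar> \<le> (2 * C + 1) * \<bar>y - x\<bar>" for x y
    using low[of x y] up[of x y] low[of y x] up[of y x] by (cases "x \<le> y") auto
  have "(2 * C + 1)-lipschitz_on UNIV \<psi>"
    using lip\<psi> C by (auto simp: lipschitz_on_def dist_real_def)
  then have cont: "continuous_on A \<psi>" for A
    using lipschitz_on_continuous_on continuous_on_subset by blast
  have surj: "\<exists>x. \<psi> x = z" for z
  proof -
    \<comment> \<open>As \<psi> grows at least with unit speed, the interval from \<open>-r\<close>
      to \<open>r\<close> is long enough for the value \<open>z\<close> to be reached.\<close>
    define r where "r = \<bar>z - \<psi> 0\<bar>"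
    have "\<psi> (- r) \<le> z" "z \<le> \<psi> r" "- r \<le> r" using low[of 0 r] low[of "-r" 0] by (auto simp: r_def)
    then show ?thesis using IVT'[of \<psi> "-r" z r] cont by auto
  qed
  define \<kappa> where "\<kappa> = inv \<psi>"
  have \<psi>\<kappa>: "\<psi> (\<kappa> z) = z" for z unfolding \<kappa>_def using surj[of z] by (auto intro: f_inv_into_f)
  have \<kappa>\<psi>: "\<kappa> (\<psi> x) = x" for x
    using \<psi>\<kappa>[of "\<psi> x"] mono[of x "\<kappa> (\<psi> x)"] mono[of "\<kappa> (\<psi> x)" x] by simp
  have vim: "\<kappa> -` A = \<psi> ` A" for A proof (intro set_eqI iffI)
    fix z assume "z \<in> \<kappa> -` A" then show "z \<in> \<psi> ` A" by (intro image_eqI[of _ _ "\<kappa> z"]) (auto simp: \<psi>\<kappa>)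
  qed (auto simp: \<kappa>\<psi>)
  have "mono \<kappa>" by (intro monoI) (metis \<psi>\<kappa> mono)
  then have [measurable]: "\<kappa> \<in> borel_measurable borel" by (rule borel_measurable_mono)
  define \<mu> where "\<mu> = distr lborel borel \<kappa>"
  have "absolutely_continuous lborel \<mu>"
    unfolding absolutely_continuous_def
  proof
    fix N :: "real set" assume N: "N \<in> null_sets lborel"
    then have [measurable]: "N \<in> sets borel" by auto
    \<comment> \<open>This is where the upper Lipschitz bound of \<psi> enters; it yields absolute
      continuity of \<mu>.\<close>
    have "negligible (\<psi> ` N)"
    proof (rule negligible_locally_Lipschitz_image)
      show "negligible N" using N by (metis negligible_iff_null_sets null_sets_completionI)
      fix x assume "x \<in> N"
      show "\<exists>T B. open T \<and> x \<in> T \<and> (\<forall>y\<in>N \<inter> T. norm (\<psi> y - \<psi> x) \<le> B * norm (y - x))"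
        by (rule exI[of _ UNIV]) (use lip\<psi> in auto)
    qed simp
    then have "\<kappa> -` N \<in> null_sets lebesgue" by (simp add: vim negligible_iff_null_sets)
    moreover have "\<kappa> -` N \<in> sets lborel" using measurable_sets_borel[of \<kappa> borel N] by simp
    ultimately show "N \<in> null_sets \<mu>"
      unfolding \<mu>_def by (simp add: null_sets_distr_iff null_sets_completion_iff)
  qed
  then obtain f where f[measurable]: "f \<in> borel_measurable lborel" and dens: "density lborel f = \<mu>"
    using sigma_finite_measure.Radon_Nikodym[OF sigma_finite_lborel, of \<mu>] by (auto simp: \<mu>_def)
  have fint: "(\<integral>\<^sup>+z. f z * indicator {x..y} z \<partial>lborel) = ennreal (\<psi> y - \<psi> x)" if "x \<le> y" for x y
  proof -
    have "(\<integral>\<^sup>+z. f z * indicator {x..y} z \<partial>lborel) = emeasure \<mu> {x..y}"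
      unfolding dens[symmetric] by (subst emeasure_density) auto
    also have "\<dots> = emeasure lborel (\<kappa> -` {x..y})" unfolding \<mu>_def by (subst emeasure_distr) auto
    also have "\<kappa> -` {x..y} = {\<psi> x..\<psi> y}"
      using mono[of x "\<kappa> _"] mono[of "\<kappa> _" y] by (auto simp: \<psi>\<kappa>)
    also have "emeasure lborel \<dots> = ennreal (\<psi> y - \<psi> x)" using that mono by simp
    finally show ?thesis .
  qed
  \<comment> \<open>The density may take the value \<infinity>, but its integral over every bounded
    interval is finite, so passing to \<open>g\<close> alters it only on null sets.\<close>
  define g where "g z = enn2real (f z)" for z
  have [measurable]: "g \<in> borel_measurable borel" unfolding g_def by measurable
  have gint: "(g has_integral (\<psi> y - \<psi> x)) {x..y}" if "x \<le> y" for x y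
  proof -
    have "AE z in lborel. f z * indicator {x..y} z \<noteq> \<infinity>"
      by (rule nn_integral_PInf_AE) (use fint[OF that] in auto)
    then have "(\<integral>\<^sup>+z. ennreal (g z * indicator {x..y} z) \<partial>lborel) = (\<integral>\<^sup>+z. f z * indicator {x..y} z \<partial>lborel)"
      by (intro nn_integral_cong_AE) (auto elim!: eventually_mono simp: g_def indicator_def less_top)
    then have "((\<lambda>z. g z * indicator {x..y} z) has_integral (\<psi> y - \<psi> x)) UNIV"
      using fint[OF that] mono[of x y] that by (intro nn_integral_has_integral) (auto simp: g_def)
    moreover have "(\<lambda>z. g z * indicator {x..y} z) = (\<lambda>z. if z \<in> {x..y} then g z else 0)" by auto
    ultimately show ?thesis using has_integral_restrict_UNIV by metis
  qed
  \<comment> \<open>The differentiation theorem applied below averages over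
    \<open>[x, x + h]\<close> with \<open>h > 0\<close> only. Reflecting the line supplies the
    averages to the left of a point.\<close>
  have gint': "((\<lambda>z. g (- z)) has_integral (\<psi> (- x) - \<psi> (- y))) {x..y}" if "x \<le> y" for x y
    using has_integral_reflect_lemma_real[OF gint[of "-y" "-x"]] that by simp
  have gi: "g integrable_on cbox x y" "(\<lambda>z. g (- z)) integrable_on cbox x y" for x y
    using gint[of x y] gint'[of x y] by (cases "x \<le> y"; auto)+
  obtain N1 where N1: "negligible N1" and d1: "\<And>x e. x \<notin> N1 \<Longrightarrow> 0 < e \<Longrightarrow>
      \<exists>d>0. \<forall>h. 0 < h \<and> h < d \<longrightarrow> norm (integral (cbox x (x + h *\<^sub>R One)) g /\<^sub>R h ^ DIM(real) - g x) < e"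
    using integrable_ccontinuous_explicit[of g] gi by metis
  obtain N2 where N2: "negligible N2" and d2: "\<And>x e. x \<notin> N2 \<Longrightarrow> 0 < e \<Longrightarrow>
      \<exists>d>0. \<forall>h. 0 < h \<and> h < d \<longrightarrow> norm (integral (cbox x (x + h *\<^sub>R One)) (\<lambda>z. g (- z)) /\<^sub>R h ^ DIM(real) - g (- x)) < e"
    using integrable_ccontinuous_explicit[of "\<lambda>z. g (- z)"] gi by metis
  have "\<phi> field_differentiable (at x)" if x: "x \<notin> N1" "- x \<notin> N2" for x
  proof -
    have "((\<lambda>h. (\<psi> (x + h) - \<psi> x) / h) \<longlongrightarrow> g x) (at 0)"
      unfolding LIM_eq
    proof (intro allI impI)
      fix e :: real assume "0 < e"
      obtain r where r: "r > 0" "\<And>h. 0 < h \<Longrightarrow> h < r \<Longrightarrow> \<bar>(\<psi> (x + h) - \<psi> x) / h - g x\<bar> < e"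
        using d1[OF x(1) \<open>0 < e\<close>] integral_unique[OF gint[of x]] 
        by (force simp: divide_inverse mult.commute)
      obtain l where l: "l > 0" "\<And>h. 0 < h \<Longrightarrow> h < l \<Longrightarrow> \<bar>(\<psi> x - \<psi> (x - h)) / h - g x\<bar> < e"
        using d2[OF x(2) \<open>0 < e\<close>] integral_unique[OF gint'[of "-x"]] 
        by (force simp: divide_inverse mult.commute)
      show "\<exists>s>0. \<forall>h. h \<noteq> 0 \<and> norm (h - 0) < s \<longrightarrow> norm ((\<psi> (x + h) - \<psi> x) / h - g x) < e"
      proof (intro exI[of _ "min r l"] conjI allI impI)
        fix h :: real assume h: "h \<noteq> 0 \<and> norm (h - 0) < min r l"
        show "norm ((\<psi> (x + h) - \<psi> x) / h - g x) < e"
        proof (cases "h > 0")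
          case True then show ?thesis using r(2)[of h] h by simp
        next
          case False
          then show ?thesis using l(2)[of "-h"] h by (simp add: minus_divide_left[symmetric] minus_divide_right[symmetric] diff_divide_distrib)
        qed
      qed (use r l in auto)
    qed
    then have "(\<psi> has_field_derivative g x) (at x)" by (simp add: DERIV_def)
    then have "((\<lambda>y. \<psi> y - (C + 1) * y) has_field_derivative (g x - (C + 1) * 1)) (at x)"
      by (auto intro!: derivative_eq_intros)
    then show ?thesis by (auto simp: \<psi>_def field_differentiable_def)
  qed
  then have "{x. \<not> \<phi> field_differentiable (at x)} \<subseteq> N1 \<union> uminus ` N2" by force
  moreover have "negligible (uminus ` N2)"
    by (rule negligible_locally_Lipschitz_image[OF _ N2]) (simp, rule exI[of _ UNIV], rule exI[of _ 1], auto)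
  ultimately show ?thesis using N1 by (meson negligible_Un negligible_subset)
qed

section \<open>Partial derivatives of Lipschitz functions\<close>

text \<open>McShane's extension: the lower envelope of the cones of slope \<open>C\<close> erected
  over the graph of \<open>v\<close>.\<close>

lemma lipschitz_extension_UNIV:
  fixes v :: "'a::metric_space \<Rightarrow> real"
  assumes "C-lipschitz_on X v"
  obtains V where "C-lipschitz_on UNIV V" and "\<And>x. x \<in> X \<Longrightarrow> V x = v x"
proof (cases "X = {}")
  case True
  \<comment> \<open>Over an empty set the infimum would be unspecified, so a constant is taken
    instead.\<close>
  have "C-lipschitz_on UNIV (\<lambda>_::'a. 0::real)" using assms by (auto simp: lipschitz_on_def)
  then show ?thesis using True that by blast
next
  case False
  have lip: "v x - v y \<le> C * dist x y" if "x \<in> X" "y \<in> X" for x y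
    using assms that by (auto simp: lipschitz_on_def dist_real_def abs_le_iff)
  have C: "C \<ge> 0" using assms by (simp add: lipschitz_on_def)
  define V where "V x = (INF y\<in>X. v y + C * dist x y)" for x
  \<comment> \<open>This bounds the cones at \<open>x\<close> from below, and for
    \<open>z = x\<close> it shows that on \<open>X\<close> the envelope does not fall below
    \<open>v\<close>.\<close>
  have ge: "v z - C * dist x z \<le> v y + C * dist x y" if "y \<in> X" "z \<in> X" for x y z
  proof -
    have "v z - v y \<le> C * (dist x z + dist x y)"
      using lip[OF that(2,1)] mult_left_mono[OF dist_triangle2[of z y x] C] by (simp add: dist_commute)
    then show ?thesis by (simp add: algebra_simps)
  qed
  have bdd: "bdd_below ((\<lambda>y. v y + C * dist x y) ` X)" for x
  proof -
    obtain z where "z \<in> X" using False by blast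
    then show ?thesis using ge by (intro bdd_belowI2) blast
  qed
  have V_le: "V x \<le> v y + C * dist x y" if "y \<in> X" for x y
    unfolding V_def by (rule cINF_lower[OF bdd that])
  have "V x - C * dist x x' \<le> V x'" for x x'
    unfolding V_def[of x']
  proof (rule cINF_greatest[OF False])
    fix y assume "y \<in> X"
    then show "V x - C * dist x x' \<le> v y + C * dist x' y"
      using V_le[of y x] mult_left_mono[OF dist_triangle[of x y x'] C] by (simp add: algebra_simps)
  qed
  then have "\<bar>V x - V x'\<bar> \<le> C * dist x x'" for x x'
    by (smt (verit) dist_commute)
  then have "C-lipschitz_on UNIV V" using C by (auto simp: lipschitz_on_def dist_real_def)
  moreover have "V x = v x" if "x \<in> X" for x
  proof (rule antisym)
    show "V x \<le> v x" using V_le[OF that, of x] by simp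
    show "v x \<le> V x" unfolding V_def by (rule cINF_greatest[OF False]) (use ge[OF _ that, of _ x] in auto)
  qed
  ultimately show ?thesis using that by blast
qed

section \<open>Measurability and existence of directional derivatives\<close>

text \<open>Differentiability is expressed through countably many difference quotients, and the
  derivative through a sequential limit, so that both become measurable in a parameter. Continuity
  of \<open>h\<close> carries the estimate from rational to real increments.\<close>

lemma field_differentiable_0_iff_quotients:
  fixes h :: "real \<Rightarrow> real"
  assumes cont: "continuous_on UNIV h"
  defines "q \<equiv> \<lambda>s. (h s - h 0) / s"
  defines "L \<equiv> lim (\<lambda>n. q (1 / real (Suc n)))"
  shows "h field_differentiable (at 0) \<longleftrightarrow>
    (\<forall>k. \<exists>m. \<forall>r::rat. r \<noteq> 0 \<longrightarrow> \<bar>of_rat r\<bar> < 1 / real (Suc m) \<longrightarrow> \<bar>q (of_rat r) - L\<bar> \<le> 1 / real (Suc k))"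
    (is "?D \<longleftrightarrow> ?R")
    and "h field_differentiable (at 0) \<Longrightarrow> deriv h 0 = L"
proof -
  have deriv_lim: "(h has_field_derivative D) (at 0) \<longleftrightarrow> (q \<longlongrightarrow> D) (at 0)" for D
    by (simp add: DERIV_def q_def)
  have L: "L = D" if "(q \<longlongrightarrow> D) (at 0)" for D
  proof -
    have "filterlim (\<lambda>n. 1 / real (Suc n)) (at 0) sequentially"
      unfolding filterlim_at using LIMSEQ_inverse_real_of_nat by (simp add: inverse_eq_divide)
    then have "(\<lambda>n. q (1 / real (Suc n))) \<longlonglongrightarrow> D" by (rule filterlim_compose[OF that])
    then show ?thesis unfolding L_def by (rule limI)
  qed
  show "deriv h 0 = L" if "h field_differentiable (at 0)"
    using that L deriv_lim DERIV_imp_deriv unfolding field_differentiable_def by metis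
  show "?D \<longleftrightarrow> ?R"
  proof
    assume ?D
    then have lim: "(q \<longlongrightarrow> L) (at 0)" using L deriv_lim unfolding field_differentiable_def by metis
    show ?R
    proof
      fix k
      obtain d where "d > 0" and d: "\<And>s. s \<noteq> 0 \<Longrightarrow> \<bar>s\<bar> < d \<Longrightarrow> \<bar>q s - L\<bar> < 1 / real (Suc k)"
        using lim[unfolded LIM_eq, rule_format, of "1 / real (Suc k)"] by auto
      obtain m where "1 / real (Suc m) < d"
        using reals_Archimedean[OF \<open>d > 0\<close>] by (auto simp: inverse_eq_divide)
      then show "\<exists>m. \<forall>r::rat. r \<noteq> 0 \<longrightarrow> \<bar>of_rat r\<bar> < 1 / real (Suc m) \<longrightarrow> \<bar>q (of_rat r) - L\<bar> \<le> 1 / real (Suc k)"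
        using d by (intro exI[of _ m]) (force intro: less_imp_le)
    qed
  next
    \<comment> \<open>If the quotients along \<open>1 / Suc n\<close> diverge, \<open>L\<close> is
      an arbitrary value; this is harmless, because \<open>?R\<close> forces \<open>q\<close> to
      tend to \<open>L\<close> whatever \<open>L\<close> is.\<close>
    assume R: ?R
    have "(q \<longlongrightarrow> L) (at 0)"
      unfolding LIM_eq
    proof (intro allI impI)
      fix e :: real assume "0 < e"
      then obtain k where k: "1 / real (Suc k) < e"
        using reals_Archimedean by (auto simp: inverse_eq_divide)
      obtain m where m: "\<And>r::rat. r \<noteq> 0 \<Longrightarrow> \<bar>of_rat r\<bar> < 1 / real (Suc m) \<Longrightarrow> \<bar>q (of_rat r) - L\<bar> \<le> 1 / real (Suc k)"
        using R by meson
      \<comment> \<open>Away from 0 the quotient is continuous, so a violation of the estimate at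
        one point of the punctured interval persists on a ball, which contains a rational.\<close>
      define A where "A = {- (1 / real (Suc m))<..<1 / real (Suc m)} - {0}"
      have "open A" unfolding A_def by (intro open_Diff) auto
      have "continuous_on A (\<lambda>s. \<bar>q s - L\<bar>)"
        unfolding q_def A_def by (intro continuous_intros continuous_on_subset[OF cont]) auto
      then have op: "open (A \<inter> (\<lambda>s. \<bar>q s - L\<bar>) -` {1 / real (Suc k)<..})"
        using \<open>open A\<close> by (intro continuous_open_preimage) auto
      have "\<bar>q s - L\<bar> \<le> 1 / real (Suc k)" if s: "s \<in> A" for s
      proof (rule ccontr)
        assume "\<not> ?thesis"
        then have "s \<in> A \<inter> (\<lambda>s. \<bar>q s - L\<bar>) -` {1 / real (Suc k)<..}" using s by auto
        then obtain \<epsilon> where "\<epsilon> > 0" and \<epsilon>: "ball s \<epsilon> \<subseteq> A \<inter> (\<lambda>s. \<bar>q s - L\<bar>) -` {1 / real (Suc k)<..}"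
          using op openE by blast
        obtain r where r: "s < of_rat r" "of_rat r < s + \<epsilon>" using of_rat_dense[of s "s + \<epsilon>"] \<open>\<epsilon> > 0\<close> by auto
        then have "of_rat r \<in> ball s \<epsilon>" by (auto simp: dist_real_def)
        then have "of_rat r \<in> A" "\<bar>q (of_rat r) - L\<bar> > 1 / real (Suc k)" using \<epsilon> by auto
        then have "r \<noteq> 0" "- (1 / real (Suc m)) < of_rat r" "of_rat r < 1 / real (Suc m)" by (auto simp: A_def)
        then have "\<bar>of_rat r\<bar> < 1 / real (Suc m)" by linarith
        then show False using m[OF \<open>r \<noteq> 0\<close>] \<open>\<bar>q (of_rat r) - L\<bar> > 1 / real (Suc k)\<close> by linarith
      qed
      then show "\<exists>d>0. \<forall>s. s \<noteq> 0 \<and> norm (s - 0) < d \<longrightarrow> norm (q s - L) < e"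
        using k by (intro exI[of _ "1 / real (Suc m)"]) (fastforce simp: A_def abs_less_iff)
    qed
    then show ?D using deriv_lim field_differentiable_def by blast
  qed
qed

text \<open>The default value of \<open>deriv\<close> is the same for all functions and points.
  Hence the partial derivatives stay measurable across the set where they do not exist.\<close>

lemma deriv_not_differentiable:
  "\<not> f field_differentiable (at x) \<Longrightarrow> deriv f x = (SOME D. False)"
  by (simp add: deriv_def field_differentiable_def)

lemma directional_derivative_borel:
  fixes V :: "'a::euclidean_space \<Rightarrow> real"
  assumes "continuous_on UNIV V"
  shows "{x. (\<lambda>t. V (x + t *\<^sub>R b)) field_differentiable (at 0)} \<in> sets borel"
    and "(\<lambda>x. deriv (\<lambda>t. V (x + t *\<^sub>R b)) 0) \<in> borel_measurable borel"
proof -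
  have V[measurable]: "V \<in> borel_measurable borel" using assms by (rule borel_measurable_continuous_onI)
  have cont: "continuous_on UNIV (\<lambda>t. V (x + t *\<^sub>R b))" for x
    by (intro continuous_on_compose2[OF assms] continuous_intros) auto
  define q where "q x s = (V (x + s *\<^sub>R b) - V x) / s" for x s
  have [measurable]: "(\<lambda>x. q x s) \<in> borel_measurable borel" for s
    unfolding q_def by measurable
  define L where "L x = lim (\<lambda>n. q x (1 / real (Suc n)))" for x
  have [measurable]: "L \<in> borel_measurable borel"
    unfolding L_def by (rule borel_measurable_lim_metric) measurable
  define D where "D = {x. (\<lambda>t. V (x + t *\<^sub>R b)) field_differentiable (at 0)}"
  have "D = {x \<in> space borel. \<forall>k. \<exists>m. \<forall>r::rat. r \<noteq> 0 \<longrightarrow> \<bar>of_rat r\<bar> < 1 / real (Suc m) \<longrightarrow> \<bar>q x (of_rat r) - L x\<bar> \<le> 1 / real (Suc k)}"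
    unfolding D_def field_differentiable_0_iff_quotients(1)[OF cont] by (simp add: q_def L_def)
  also have "\<dots> \<in> sets borel" by measurable
  finally have [measurable]: "D \<in> sets borel" .
  then show "{x. (\<lambda>t. V (x + t *\<^sub>R b)) field_differentiable (at 0)} \<in> sets borel" by (simp add: D_def)
  have "(\<lambda>x. deriv (\<lambda>t. V (x + t *\<^sub>R b)) 0) = (\<lambda>x. if x \<in> D then L x else (SOME D. False))"
    using field_differentiable_0_iff_quotients(2)[OF cont] deriv_not_differentiable
    by (auto simp: D_def L_def q_def fun_eq_iff)
  then show "(\<lambda>x. deriv (\<lambda>t. V (x + t *\<^sub>R b)) 0) \<in> borel_measurable borel" by simp
qed

text \<open>On each line parallel to \<open>b\<close> the exceptional set \<open>N\<close> is null
  by the one-dimensional result. Fubini's theorem is applied to translates of \<open>N\<close> along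
  \<open>b\<close>, so no coordinate system adapted to \<open>b\<close> has to be chosen.\<close>

lemma lipschitz_AE_directional_derivative:
  fixes V :: "'a::euclidean_space \<Rightarrow> real"
  assumes lip: "C-lipschitz_on UNIV V"
  shows "AE x in lborel. (\<lambda>t. V (x + t *\<^sub>R b)) field_differentiable (at 0)"
proof -
  define N where "N = - {x. (\<lambda>t. V (x + t *\<^sub>R b)) field_differentiable (at 0)}"
  have N[measurable]: "N \<in> sets borel"
    unfolding N_def using directional_derivative_borel(1)[OF lipschitz_on_continuous_on[OF lip], of b] by auto
  have translate: "(\<integral>\<^sup>+x. indicator N (x + t *\<^sub>R b) \<partial>lborel) = emeasure lborel N" for t
  proof -
    have "emeasure lborel N = (\<integral>\<^sup>+x. indicator N x \<partial>(distr lborel borel ((+) (t *\<^sub>R b))))"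
      by (simp add: lborel_distr_plus)
    also have "\<dots> = (\<integral>\<^sup>+x. indicator N (t *\<^sub>R b + x) \<partial>lborel)"
      by (subst nn_integral_distr) auto
    finally show ?thesis by (simp add: add.commute)
  qed
  have line: "(\<integral>\<^sup>+t. indicator {0..1} t * indicator N (x + t *\<^sub>R b) \<partial>lborel) = 0" for x
  proof -
    let ?\<phi> = "\<lambda>t. V (x + t *\<^sub>R b)"
    have "(C * norm b)-lipschitz_on UNIV ?\<phi>"
    proof (rule lipschitz_onI)
      show "0 \<le> C * norm b" using lip by (simp add: lipschitz_on_def)
      fix s t :: real
      have "dist (?\<phi> s) (?\<phi> t) \<le> C * dist (x + s *\<^sub>R b) (x + t *\<^sub>R b)"
        using lip unfolding lipschitz_on_def by blast
      also have "dist (x + s *\<^sub>R b) (x + t *\<^sub>R b) = norm b * dist s t"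
        by (simp add: dist_norm flip: scaleR_diff_left)
      finally show "dist (?\<phi> s) (?\<phi> t) \<le> C * norm b * dist s t" by (simp add: ac_simps)
    qed
    then have neg: "negligible {t. \<not> ?\<phi> field_differentiable (at t)}" by (rule lipschitz_real_AE_differentiable)
    have "(\<lambda>s. V ((x + t *\<^sub>R b) + s *\<^sub>R b)) field_differentiable (at 0) \<longleftrightarrow> ?\<phi> field_differentiable (at t)" for t
      unfolding field_differentiable_def using DERIV_shift[of ?\<phi> _ 0 t]
      by (simp add: algebra_simps)
    then have eq: "{t. x + t *\<^sub>R b \<in> N} = {t. \<not> ?\<phi> field_differentiable (at t)}" by (auto simp: N_def)
    have "{t. x + t *\<^sub>R b \<in> N} \<in> sets lborel" by measurable
    then have "{t. x + t *\<^sub>R b \<in> N} \<in> null_sets lborel"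
      using neg null_sets_completion_iff[of _ lborel] unfolding eq negligible_iff_null_sets by blast
    then have "AE t in lborel. x + t *\<^sub>R b \<notin> N" using AE_not_in by fastforce
    then have "(\<integral>\<^sup>+t. indicator {0..1} t * indicator N (x + t *\<^sub>R b) \<partial>lborel) = (\<integral>\<^sup>+t. 0 \<partial>(lborel::real measure))"
      by (intro nn_integral_cong_AE) (auto simp: indicator_def)
    then show ?thesis by simp
  qed
  \<comment> \<open>Translation invariance lets the measure of \<open>N\<close> be averaged over the
    shifts \<open>t *\<^sub>R b\<close> with \<open>t\<close> in \<open>[0, 1]\<close>. After
    exchanging the integrals, the inner one measures a piece of a line inside \<open>N\<close> and
    vanishes.\<close>
  have "emeasure lborel N = (\<integral>\<^sup>+t. indicator {0..1::real} t * emeasure lborel N \<partial>lborel)"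
    by (subst nn_integral_multc) auto
  also have "\<dots> = (\<integral>\<^sup>+t. \<integral>\<^sup>+x. indicator {0..1::real} t * indicator N (x + t *\<^sub>R b) \<partial>lborel \<partial>lborel)"
    by (subst nn_integral_cmult) (auto simp: translate)
  also have "\<dots> = (\<integral>\<^sup>+x. \<integral>\<^sup>+t. indicator {0..1::real} t * indicator N (x + t *\<^sub>R b) \<partial>lborel \<partial>lborel)"
    by (rule lborel_pair.Fubini'[symmetric]) measurable
  also have "\<dots> = 0" by (simp add: line)
  finally have "N \<in> null_sets lborel" by (auto simp: null_sets_def)
  then show ?thesis using AE_not_in by (force simp: N_def)
qed

section \<open>Gradients of Lipschitz functions\<close>

text \<open>Marks the points at which every \<open>deriv\<close> in \<open>grad\<close> is a genuine
  derivative and not its default value, so that the rules for sums and multiples apply.\<close>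

definition partially_differentiable :: "('a::euclidean_space \<Rightarrow> real) \<Rightarrow> 'a \<Rightarrow> bool" where
  "partially_differentiable v x \<longleftrightarrow> (\<forall>b\<in>Basis. (\<lambda>t. v (x + t *\<^sub>R b)) field_differentiable (at 0))"

lemma eventually_line_in_open:
  fixes x b :: "'a::real_normed_vector"
  assumes "open \<Omega>" "x \<in> \<Omega>"
  shows "eventually (\<lambda>t::real. x + t *\<^sub>R b \<in> \<Omega>) (nhds 0)"
proof -
  have "open ((\<lambda>t::real. x + t *\<^sub>R b) -` \<Omega>)" using assms by (intro open_vimage continuous_intros)
  then show ?thesis using assms by (auto dest: eventually_nhds_in_open[of _ 0])
qed

text \<open>Each point of the open set \<Omega> has a neighbourhood on which \<open>v\<close> agrees
  with its extension to the whole space, so both have the same partial derivatives there.\<close>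

lemma lipschitz_grad_regular:
  fixes v :: "'a::euclidean_space \<Rightarrow> real"
  assumes "open \<Omega>" and "C-lipschitz_on \<Omega> v"
  shows lipschitz_AE_partially_differentiable: "AE x in lebesgue_on \<Omega>. partially_differentiable v x"
    and lipschitz_grad_measurable: "grad v \<in> borel_measurable (lebesgue_on \<Omega>)"
proof -
  obtain V where V: "C-lipschitz_on UNIV V" and eq: "\<And>x. x \<in> \<Omega> \<Longrightarrow> V x = v x"
    using lipschitz_extension_UNIV[OF assms(2)] by metis
  have ev: "\<forall>\<^sub>F t in nhds 0. V (x + t *\<^sub>R b) = v (x + t *\<^sub>R b)" if "x \<in> \<Omega>" for x b
    using eventually_line_in_open[OF assms(1) that, of b] by eventually_elim (simp add: eq)
  have fd: "(\<lambda>t. v (x + t *\<^sub>R b)) field_differentiable (at 0) \<longleftrightarrow> (\<lambda>t. V (x + t *\<^sub>R b)) field_differentiable (at 0)"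
    if "x \<in> \<Omega>" for x b
    unfolding field_differentiable_def using DERIV_cong_ev[OF refl ev[OF that] refl] by blast
  have "AE x in lborel. \<forall>b\<in>Basis. (\<lambda>t. V (x + t *\<^sub>R b)) field_differentiable (at 0)"
    using lipschitz_AE_directional_derivative[OF V] by (subst AE_finite_all) auto
  then have "AE x in lebesgue. x \<in> \<Omega> \<longrightarrow> partially_differentiable v x"
    using AE_completion by (fastforce simp: partially_differentiable_def fd elim!: eventually_mono)
  moreover have \<Omega>: "\<Omega> \<in> sets lebesgue" using assms(1) by (simp add: borel_open)
  ultimately show "AE x in lebesgue_on \<Omega>. partially_differentiable v x" by (simp add: AE_restrict_space_iff)
  have "grad V \<in> borel_measurable borel"
    unfolding grad_def using directional_derivative_borel(2)[OF lipschitz_on_continuous_on[OF V]]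
    by (intro borel_measurable_sum borel_measurable_scaleR borel_measurable_const)
  then have "grad V \<in> borel_measurable lebesgue" by (intro measurable_completion) simp
  then have "grad V \<in> borel_measurable (lebesgue_on \<Omega>)" by (rule measurable_restrict_space1)
  moreover have "grad v x = grad V x" if "x \<in> \<Omega>" for x
    unfolding grad_def by (intro sum.cong refl arg_cong2[where f = scaleR] deriv_cong_ev)
      (use ev[OF that] in \<open>simp_all add: eq_commute\<close>)
  ultimately show "grad v \<in> borel_measurable (lebesgue_on \<Omega>)"
    by (subst measurable_cong[where g = "grad V"]) (auto simp: space_restrict_space)
qed

text \<open>Every difference quotient, hence every partial derivative, is at most \<open>C\<close>
  in absolute value; the dimension comes from the triangle inequality over the basis. This crude
  bound suffices for controlling small perturbations.\<close>

lemma norm_grad_le_lipschitz: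
  fixes v :: "'a::euclidean_space \<Rightarrow> real" and C :: real
  assumes "open \<Omega>" and lip: "C-lipschitz_on \<Omega> v" and x: "x \<in> \<Omega>" and "partially_differentiable v x"
  shows "norm (grad v x) \<le> real DIM('a) * C"
proof -
  have "\<bar>deriv (\<lambda>t. v (x + t *\<^sub>R b)) 0\<bar> \<le> C" if b: "b \<in> Basis" for b
  proof -
    have "((\<lambda>t. v (x + t *\<^sub>R b)) has_field_derivative deriv (\<lambda>t. v (x + t *\<^sub>R b)) 0) (at 0)"
      using assms(4) b by (simp add: partially_differentiable_def DERIV_deriv_iff_field_differentiable)
    then have lim: "((\<lambda>h. (v (x + h *\<^sub>R b) - v x) / h) \<longlongrightarrow> deriv (\<lambda>t. v (x + t *\<^sub>R b)) 0) (at 0)"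
      by (simp add: DERIV_def)
    have "\<forall>\<^sub>F h in at 0. x + h *\<^sub>R b \<in> \<Omega>"
      using eventually_line_in_open[OF assms(1) x, of b] by (simp add: eventually_at_filter eventually_mono)
    then have "\<forall>\<^sub>F h in at 0. norm ((v (x + h *\<^sub>R b) - v x) / h) \<le> C"
    proof eventually_elim
      case (elim h)
      have "dist (v (x + h *\<^sub>R b)) (v x) \<le> C * dist (x + h *\<^sub>R b) x"
        using lip elim x unfolding lipschitz_on_def by blast
      then show ?case using b lip
        by (cases "h = 0") (auto simp: dist_norm field_simps lipschitz_on_def)
    qed
    then have "norm (deriv (\<lambda>t. v (x + t *\<^sub>R b)) 0) \<le> C" by (intro Lim_norm_ubound[OF _ lim]) auto
    then show ?thesis by simp
  qed
  then have "(\<Sum>b\<in>Basis. norm (deriv (\<lambda>t. v (x + t *\<^sub>R b)) 0 *\<^sub>R b)) \<le> (\<Sum>b\<in>(Basis::'a set). (C::real))"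
    by (intro sum_mono) simp
  then have "(\<Sum>b\<in>Basis. norm (deriv (\<lambda>t. v (x + t *\<^sub>R b)) 0 *\<^sub>R b)) \<le> real DIM('a) * C"
    by simp
  then show ?thesis unfolding grad_def by (rule order_trans[OF norm_sum])
qed

lemma grad_add_scaled:
  assumes "partially_differentiable v x" "partially_differentiable w x"
  shows "grad (\<lambda>y. v y + r * w y) x = grad v x + r *\<^sub>R grad w x"
proof -
  have "deriv (\<lambda>t. v (x + t *\<^sub>R b) + r * w (x + t *\<^sub>R b)) 0
      = deriv (\<lambda>t. v (x + t *\<^sub>R b)) 0 + r * deriv (\<lambda>t. w (x + t *\<^sub>R b)) 0" if "b \<in> Basis" for b
    using assms that unfolding partially_differentiable_def
    by (intro DERIV_imp_deriv DERIV_add DERIV_cmult) (auto simp: DERIV_deriv_iff_field_differentiable)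
  then show ?thesis
    by (simp add: grad_def scaleR_add_left sum.distrib scaleR_sum_right)
qed

lemma lipschitz_fun_add_scaled:
  assumes "lipschitz_fun X v" "lipschitz_fun X w"
  shows "lipschitz_fun X (\<lambda>y. v y + r * w y)"
proof -
  obtain B C where "B-lipschitz_on X v" "C-lipschitz_on X w" using assms by (auto simp: lipschitz_fun_def)
  then have "(B + \<bar>r\<bar> * C)-lipschitz_on X (\<lambda>y. v y + r *\<^sub>R w y)"
    by (intro lipschitz_intros) auto
  then show ?thesis by (auto simp: lipschitz_fun_def)
qed

lemma lipschitz_fun_closure:
  assumes "lipschitz_fun (closure \<Omega>) v"
  obtains C where "C-lipschitz_on \<Omega> v"
  using assms closure_subset lipschitz_on_subset by (metis lipschitz_fun_def)

lemma lebesgue_on_bounded_open: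
  assumes "open \<Omega>" "bounded \<Omega>"
  shows "finite_measure (lebesgue_on \<Omega>)"
  using assms by (simp add: finite_measure_lebesgue_on lmeasurable_open)

text \<open>A Lipschitz function is bounded on a bounded set, so the product is dominated by a
  multiple of \<open>f\<close>. This makes the linear term of \<open>F\<close> additive.\<close>

lemma integrable_mult_lipschitz:
  fixes v :: "'a::euclidean_space \<Rightarrow> real"
  assumes "open \<Omega>" "bounded \<Omega>" and v: "lipschitz_fun (closure \<Omega>) v" and f: "integrable (lebesgue_on \<Omega>) f"
  shows "integrable (lebesgue_on \<Omega>) (\<lambda>x. f x * v x)"
proof -
  obtain C where C: "C-lipschitz_on \<Omega> v" using v by (rule lipschitz_fun_closure)
  have "bounded (v ` \<Omega>)" 
    using lipschitz_on_uniformly_continuous[OF C] assms(2) bounded_uniformly_continuous_image by blast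
  then obtain B where B: "\<And>x. x \<in> \<Omega> \<Longrightarrow> norm (v x) \<le> B" unfolding bounded_iff by auto
  have [measurable]: "v \<in> borel_measurable (lebesgue_on \<Omega>)"
    using lipschitz_on_continuous_on[OF C] assms(1)
    by (intro continuous_imp_measurable_on_sets_lebesgue) (auto simp: borel_open)
  have [measurable]: "f \<in> borel_measurable (lebesgue_on \<Omega>)" using f by auto
  have "norm (v x) * norm (f x) \<le> norm B * norm (f x)" if "x \<in> \<Omega>" for x
    using B[OF that] by (intro mult_right_mono) auto
  then have bound: "AE x in lebesgue_on \<Omega>. norm (f x * v x) \<le> norm (B * f x)"
    by (intro AE_I2) (auto simp: norm_mult abs_mult mult.commute space_restrict_space)
  show ?thesis
    by (rule Bochner_Integration.integrable_bound[OF _ _ bound]) (use f in simp, measurable)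
qed

lemma mem_S_D:
  assumes "v \<in> S \<Omega> \<sigma> g"
  shows "lipschitz_fun (closure \<Omega>) v" and "AE x in lebesgue_on \<Omega>. norm (grad v x) \<le> \<sigma>"
    and "x \<in> frontier \<Omega> \<Longrightarrow> v x = g x"
proof -
  have "AE x in lebesgue_on \<Omega>. ereal (norm (grad v x)) \<le> Linf_norm \<Omega> (grad v)"
    unfolding Linf_norm_def by (rule esssup_AE)
  moreover have "Linf_norm \<Omega> (grad v) \<le> ereal \<sigma>" using assms by (simp add: S_def)
  ultimately show "AE x in lebesgue_on \<Omega>. norm (grad v x) \<le> \<sigma>"
    by (metis (mono_tags, lifting) eventually_mono ereal_less_eq(3) order_trans)
qed (use assms in \<open>auto simp: S_def\<close>)

section \<open>Convexity of the energy density\<close>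

text \<open>A convex power lies above its tangent at \<open>t\<close>. The induction multiplies the
  previous inequality by \<open>s\<close> and uses \<open>(s - t)\<^sup>2 \<ge> 0\<close>.\<close>

lemma power_gradient_inequality:
  fixes s t :: real
  assumes "0 \<le> s" "0 \<le> t"
  shows "real (Suc k) * t ^ k * (s - t) \<le> s ^ Suc k - t ^ Suc k"
proof (induction k)
  case (Suc k)
  have "0 \<le> t ^ k * (s - t)\<^sup>2" using assms by simp
  then have "t * (t ^ k * (s - t)) \<le> s * (t ^ k * (s - t))"
    by (simp add: power2_eq_square algebra_simps)
  then have "real (Suc k) * (t * (t ^ k * (s - t))) \<le> real (Suc k) * (s * (t ^ k * (s - t)))"
    by (rule mult_left_mono) simp
  moreover have "s * (real (Suc k) * t ^ k * (s - t)) \<le> s * (s ^ Suc k - t ^ Suc k)"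
    using Suc assms by (intro mult_left_mono) auto
  ultimately show ?case by (simp add: algebra_simps)
qed simp

lemma Phi_finite_iff:
  assumes "\<And>p. p \<ge> 2 \<Longrightarrow> a p \<ge> 0" "t \<ge> 0"
  shows "Phi a t < \<infinity> \<longleftrightarrow> summable (\<lambda>n. a (n + 2) / real (n + 2) * t ^ (n + 2))"
    and "summable (\<lambda>n. a (n + 2) / real (n + 2) * t ^ (n + 2)) \<Longrightarrow>
      Phi a t = ennreal (\<Sum>n. a (n + 2) / real (n + 2) * t ^ (n + 2))"
proof -
  have nn: "0 \<le> a (n + 2) / real (n + 2) * t ^ (n + 2)" for n using assms by simp
  show 2: "Phi a t = ennreal (\<Sum>n. a (n + 2) / real (n + 2) * t ^ (n + 2))"
    if "summable (\<lambda>n. a (n + 2) / real (n + 2) * t ^ (n + 2))"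
    unfolding Phi_def by (rule suminf_ennreal2[OF nn that])
  show "Phi a t < \<infinity> \<longleftrightarrow> summable (\<lambda>n. a (n + 2) / real (n + 2) * t ^ (n + 2))"
    using 2 summable_suminf_not_top[OF nn] by (auto simp: Phi_def)
qed

text \<open>The inequality is proved for each power separately and then summed. Finiteness of
  \<open>G\<close> at \<xi> is part of the conclusion because on the sphere of radius \<sigma> only
  convergence of the flux is given.\<close>

lemma G_gradient_inequality:
  fixes \<xi> \<eta> :: "'a::euclidean_space"
  assumes a: "\<And>p. p \<ge> 2 \<Longrightarrow> a p \<ge> 0"
    and "norm \<xi> \<le> \<sigma>" and conv: "flux_converges a \<xi>" and fin: "G a \<sigma> \<eta> < \<infinity>"
  shows "G a \<sigma> \<xi> < \<infinity>"
    and "enn2real (G a \<sigma> \<xi>) + flux a \<xi> \<bullet> (\<eta> - \<xi>) \<le> enn2real (G a \<sigma> \<eta>)"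
proof -
  define s t where "s = norm \<eta>" and "t = norm \<xi>"
  have st: "s \<ge> 0" "t \<ge> 0" "t \<le> \<sigma>" using assms(2) by (auto simp: s_def t_def)
  have "s \<le> \<sigma>" using fin by (auto simp: G_def s_def split: if_splits)
  then have G: "G a \<sigma> \<xi> = Phi a t" "G a \<sigma> \<eta> = Phi a s" using st by (auto simp: G_def s_def t_def)
  define P Q c where "P n = a (n + 2) / real (n + 2) * s ^ (n + 2)"
    and "Q n = a (n + 2) / real (n + 2) * t ^ (n + 2)"
    and "c n = (a (n + 2) *\<^sub>R pflux (n + 2) \<xi>) \<bullet> (\<eta> - \<xi>)" for n
  have PQ: "P = (\<lambda>n. a (n + 2) / real (n + 2) * s ^ (n + 2))" "Q = (\<lambda>n. a (n + 2) / real (n + 2) * t ^ (n + 2))"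
    by (simp_all add: P_def Q_def fun_eq_iff)
  have sumP: "summable P" using fin Phi_finite_iff(1)[where a=a, OF a st(1)] unfolding G PQ by blast
  have c_sums: "c sums (flux a \<xi> \<bullet> (\<eta> - \<xi>))"
    using bounded_linear.sums[OF bounded_linear_inner_left summable_sums[OF conv[unfolded flux_converges_def]]]
    by (simp add: c_def[abs_def] flux_def)
  have le: "Q n + c n \<le> P n" for n
  proof -
    \<comment> \<open>Cauchy-Schwarz replaces the vectors by their norms and leaves the tangent
      inequality for the power \<open>n + 2\<close>, whose derivative factor cancels the denominator
      in \<open>Phi\<close>.\<close>
    have "\<xi> \<bullet> (\<eta> - \<xi>) \<le> t * (s - t)"
      using norm_cauchy_schwarz[of \<xi> \<eta>] by (simp add: s_def t_def inner_diff_right dot_square_norm power2_eq_square algebra_simps)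
    then have "t ^ n * (\<xi> \<bullet> (\<eta> - \<xi>)) \<le> t ^ n * (t * (s - t))" using st by (intro mult_left_mono) auto
    also have "\<dots> \<le> (s ^ (n + 2) - t ^ (n + 2)) / real (n + 2)"
      using power_gradient_inequality[of s t "n + 1"] st by (simp add: field_simps)
    finally have "a (n + 2) * (t ^ n * (\<xi> \<bullet> (\<eta> - \<xi>))) \<le> a (n + 2) * ((s ^ (n + 2) - t ^ (n + 2)) / real (n + 2))"
      using a by (intro mult_left_mono) auto
    moreover have "c n = a (n + 2) * (t ^ n * (\<xi> \<bullet> (\<eta> - \<xi>)))" by (simp add: c_def pflux_def t_def)
    moreover have "a (n + 2) * ((s ^ (n + 2) - t ^ (n + 2)) / real (n + 2)) = P n - Q n"
      by (simp add: P_def Q_def diff_divide_distrib right_diff_distrib)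
    ultimately show ?thesis by linarith
  qed
  have Qnn: "Q n \<ge> 0" for n using a st by (simp add: Q_def)
  \<comment> \<open>\<open>0 \<le> Q n \<le> P n - c n\<close>, so the series for \<xi> converges by
    comparison.\<close>
  have "summable (\<lambda>n. P n - c n)" using sumP c_sums by (intro summable_diff) (auto simp: sums_iff)
  then have sumQ: "summable Q"
    by (rule summable_comparison_test'[of _ 0]) (use le Qnn in \<open>auto simp: algebra_simps\<close>)
  then show "G a \<sigma> \<xi> < \<infinity>" using Phi_finite_iff(1)[where a=a, OF a st(2)] unfolding G PQ by blast
  have "enn2real (G a \<sigma> \<xi>) = suminf Q" "enn2real (G a \<sigma> \<eta>) = suminf P"
    using Phi_finite_iff(2)[where a=a, OF a st(2)] Phi_finite_iff(2)[where a=a, OF a st(1)] suminf_nonneg[OF sumP] suminf_nonneg[OF sumQ Qnn]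
      sumP sumQ a st unfolding G PQ by (auto intro!: enn2real_ennreal)
  moreover have "suminf Q + suminf c \<le> suminf P"
    using sumP sumQ c_sums le by (subst suminf_add) (auto simp: sums_iff intro!: suminf_le summable_add)
  ultimately show "enn2real (G a \<sigma> \<xi>) + flux a \<xi> \<bullet> (\<eta> - \<xi>) \<le> enn2real (G a \<sigma> \<eta>)"
    using c_sums by (simp add: sums_iff)
qed

section \<open>Integration of the flux series and of the gradient inequality\<close>

lemma G_measurable [measurable]: "G a \<sigma> \<in> borel_measurable borel"
  unfolding G_def Phi_def by measurable

lemma pflux_measurable [measurable]: "pflux p \<in> borel_measurable borel"
  unfolding pflux_def by measurable

lemma flux_measurable [measurable]: "flux a \<in> borel_measurable borel"
  unfolding flux_def by measurable

lemma scaleR_pflux: "a (n + 2) *\<^sub>R pflux (n + 2) \<xi> = (a (n + 2) * norm \<xi> ^ n) *\<^sub>R \<xi>"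
  by (simp add: pflux_def)

text \<open>
  The terms of the series all carry the sign of \<open>U x \<bullet> E x\<close>, so the integrability of the sum
  alone forces absolute convergence and permits the exchange of sum and integral.
\<close>

lemma flux_series_integral:
  fixes U E :: "'b \<Rightarrow> 'a::euclidean_space"
  assumes a: "\<And>p. p \<ge> 2 \<Longrightarrow> a p \<ge> 0"
    and [measurable]: "U \<in> borel_measurable M" "E \<in> borel_measurable M"
    and conv: "AE x in M. flux_converges a (U x)"
    and int: "integrable M (\<lambda>x. flux a (U x) \<bullet> E x)"
  shows "summable (\<lambda>n. a (n + 2) * \<bar>\<integral>x. pflux (n + 2) (U x) \<bullet> E x \<partial>M\<bar>)"
    and "(\<lambda>n. a (n + 2) * (\<integral>x. pflux (n + 2) (U x) \<bullet> E x \<partial>M)) sums (\<integral>x. flux a (U x) \<bullet> E x \<partial>M)"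
proof -
  define f where "f n x = a (n + 2) * (pflux (n + 2) (U x) \<bullet> E x)" for n x
  define w where "w x = flux a (U x) \<bullet> E x" for x
  have [measurable]: "f n \<in> borel_measurable M" "w \<in> borel_measurable M" for n
    unfolding f_def w_def by measurable
  have int_w: "integrable M w" using int by (simp add: w_def[abs_def])
  have sums: "AE x in M. (\<lambda>n. f n x) sums w x \<and> (\<lambda>n. \<bar>f n x\<bar>) sums \<bar>w x\<bar>"
    using conv
  proof eventually_elim
    case (elim x)
    have 1: "(\<lambda>n. f n x) sums w x"
      using bounded_linear.sums[OF bounded_linear_inner_left summable_sums[OF elim[unfolded flux_converges_def]], of "E x"]
      by (simp add: f_def w_def flux_def)
    have f: "f n x = (a (n + 2) * norm (U x) ^ n) * (U x \<bullet> E x)" for n by (simp add: f_def pflux_def)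
    have nn: "a (n + 2) * norm (U x) ^ n \<ge> 0" for n using a by simp
    show ?case
    proof (cases "U x \<bullet> E x \<ge> 0")
      case True
      then have "f n x \<ge> 0" for n using nn by (simp add: f)
      then have "\<bar>f n x\<bar> = f n x" "w x \<ge> 0" for n using sums_le[OF _ sums_zero 1] by auto
      then show ?thesis using 1 by simp
    next
      case False
      then have "f n x \<le> 0" for n using nn by (simp add: f mult_nonneg_nonpos)
      then have "\<bar>f n x\<bar> = - f n x" "w x \<le> 0" for n using sums_le[OF _ 1 sums_zero] by auto
      then show ?thesis using 1 sums_minus[OF 1] by simp
    qed
  qed
  \<comment> \<open>For a singleton \<open>A\<close> this dominates each term by the integrable
    \<open>w\<close>; for initial segments it bounds the sum of the \<open>L^1\<close>
    norms.\<close>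
  have part: "AE x in M. (\<Sum>n\<in>A. \<bar>f n x\<bar>) \<le> \<bar>w x\<bar>" if "finite A" for A
    using sums
  proof eventually_elim
    case (elim x)
    then show ?case using sum_le_suminf[OF _ that, of "\<lambda>n. \<bar>f n x\<bar>"] by (simp add: sums_iff)
  qed
  have int_f: "integrable M (f n)" for n
    using part[of "{n}"] by (intro Bochner_Integration.integrable_bound[OF int_w]) auto
  have sum_abs: "summable (\<lambda>n. \<integral>x. norm (f n x) \<partial>M)"
  proof (rule summableI_nonneg_bounded)
    fix N
    have "(\<Sum>n<N. \<integral>x. norm (f n x) \<partial>M) = (\<integral>x. (\<Sum>n<N. \<bar>f n x\<bar>) \<partial>M)"
      using int_f by (subst Bochner_Integration.integral_sum) auto
    also have "\<dots> \<le> (\<integral>x. \<bar>w x\<bar> \<partial>M)"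
      using int_f int_w part[of "{..<N}"] by (intro integral_mono_AE) auto
    finally show "(\<Sum>n<N. \<integral>x. norm (f n x) \<partial>M) \<le> (\<integral>x. \<bar>w x\<bar> \<partial>M)" .
  qed simp
  \<comment> \<open>The constant is pulled out without an integrability condition: where
    \<open>a (n + 2)\<close> is 0, nothing is known about the remaining factor.\<close>
  have integral_f: "integral\<^sup>L M (f n) = a (n + 2) * (\<integral>x. pflux (n + 2) (U x) \<bullet> E x \<partial>M)" for n
    unfolding f_def by (rule integral_mult_right_zero)
  have "(\<lambda>n. integral\<^sup>L M (f n)) sums (\<integral>x. (\<Sum>n. f n x) \<partial>M)"
    using sums by (intro sums_integral int_f sum_abs) (auto elim!: eventually_mono simp: sums_iff)
  also have "(\<integral>x. (\<Sum>n. f n x) \<partial>M) = (\<integral>x. w x \<partial>M)"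
    using sums by (intro integral_cong_AE) (auto elim!: eventually_mono simp: sums_iff)
  finally show "(\<lambda>n. a (n + 2) * (\<integral>x. pflux (n + 2) (U x) \<bullet> E x \<partial>M)) sums (\<integral>x. flux a (U x) \<bullet> E x \<partial>M)"
    by (simp only: integral_f w_def)
  have "summable (\<lambda>n. \<bar>integral\<^sup>L M (f n)\<bar>)"
    by (rule summable_comparison_test'[OF sum_abs, of 0]) (use integral_norm_bound in force)
  then show "summable (\<lambda>n. a (n + 2) * \<bar>\<integral>x. pflux (n + 2) (U x) \<bullet> E x \<partial>M\<bar>)"
    by (simp only: integral_f abs_mult) (use a in simp)
qed

text \<open>Finite energy of \<open>V\<close> passes to \<open>U\<close>: almost everywhere the
  density at \<open>U\<close> lies between 0 and the integrable \<open>P - w\<close>. Only then can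
  the pointwise inequality be integrated in the reals.\<close>

lemma integral_G_gradient_inequality:
  fixes U V :: "'b \<Rightarrow> 'a::euclidean_space"
  assumes a: "\<And>p. p \<ge> 2 \<Longrightarrow> a p \<ge> 0"
    and [measurable]: "U \<in> borel_measurable M" "V \<in> borel_measurable M"
    and le: "AE x in M. norm (U x) \<le> \<sigma>"
    and conv: "AE x in M. flux_converges a (U x)"
    and int: "integrable M (\<lambda>x. flux a (U x) \<bullet> (V x - U x))"
    and fin: "(\<integral>\<^sup>+x. G a \<sigma> (V x) \<partial>M) < \<infinity>"
  shows "(\<integral>\<^sup>+x. G a \<sigma> (U x) \<partial>M) < \<infinity>"
    and "enn2real (\<integral>\<^sup>+x. G a \<sigma> (U x) \<partial>M) + (\<integral>x. flux a (U x) \<bullet> (V x - U x) \<partial>M)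
           \<le> enn2real (\<integral>\<^sup>+x. G a \<sigma> (V x) \<partial>M)"
proof -
  define P Q w where "P x = enn2real (G a \<sigma> (V x))" and "Q x = enn2real (G a \<sigma> (U x))"
    and "w x = flux a (U x) \<bullet> (V x - U x)" for x
  have [measurable]: "P \<in> borel_measurable M" "Q \<in> borel_measurable M" "w \<in> borel_measurable M"
    unfolding P_def Q_def w_def by measurable
  have "AE x in M. G a \<sigma> (V x) \<noteq> \<infinity>" by (rule nn_integral_PInf_AE) (use fin in auto)
  with le conv have AE: "AE x in M. G a \<sigma> (V x) = ennreal (P x) \<and> G a \<sigma> (U x) = ennreal (Q x) \<and> Q x + w x \<le> P x"
  proof eventually_elim
    case (elim x)
    then have "G a \<sigma> (V x) < \<infinity>" by (simp add: less_top)
    from G_gradient_inequality[where a=a, OF a elim(1,2) this] this show ?case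
      by (simp add: P_def Q_def w_def)
  qed
  then have AE_P: "AE x in M. G a \<sigma> (V x) = ennreal (P x)" and AE_Q: "AE x in M. G a \<sigma> (U x) = ennreal (Q x)"
    and AE_le: "AE x in M. Q x + w x \<le> P x" by auto
  have int_w: "integrable M w" using int by (simp add: w_def[abs_def])
  have VP: "(\<integral>\<^sup>+x. G a \<sigma> (V x) \<partial>M) = (\<integral>\<^sup>+x. ennreal (P x) \<partial>M)"
    using AE_P by (rule nn_integral_cong_AE)
  then have int_P: "integrable M P"
    using fin by (intro integrableI_nonneg) (auto simp: P_def)
  have int_Q: "integrable M Q"
    by (rule Bochner_Integration.integrable_bound[OF Bochner_Integration.integrable_diff[OF int_P int_w]])
      (use AE_le in \<open>auto elim!: eventually_mono simp: Q_def\<close>)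
  have UQ: "(\<integral>\<^sup>+x. G a \<sigma> (U x) \<partial>M) = ennreal (\<integral>x. Q x \<partial>M)"
  proof -
    have "(\<integral>\<^sup>+x. G a \<sigma> (U x) \<partial>M) = (\<integral>\<^sup>+x. ennreal (Q x) \<partial>M)"
      using AE_Q by (rule nn_integral_cong_AE)
    also have "\<dots> = ennreal (\<integral>x. Q x \<partial>M)" by (rule nn_integral_eq_integral[OF int_Q]) (simp add: Q_def)
    finally show ?thesis .
  qed
  then show "(\<integral>\<^sup>+x. G a \<sigma> (U x) \<partial>M) < \<infinity>" by simp
  have VP': "(\<integral>\<^sup>+x. G a \<sigma> (V x) \<partial>M) = ennreal (\<integral>x. P x \<partial>M)"
    unfolding VP by (rule nn_integral_eq_integral[OF int_P]) (simp add: P_def)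
  have "(\<integral>x. Q x + w x \<partial>M) \<le> (\<integral>x. P x \<partial>M)"
    using int_P int_Q int_w AE_le by (intro integral_mono_AE) auto
  then have "(\<integral>x. Q x \<partial>M) + (\<integral>x. w x \<partial>M) \<le> (\<integral>x. P x \<partial>M)"
    using int_Q int_w by simp
  moreover have "0 \<le> (\<integral>x. P x \<partial>M)" "0 \<le> (\<integral>x. Q x \<partial>M)" by (simp_all add: P_def Q_def)
  ultimately show "enn2real (\<integral>\<^sup>+x. G a \<sigma> (U x) \<partial>M) + (\<integral>x. flux a (U x) \<bullet> (V x - U x) \<partial>M)
           \<le> enn2real (\<integral>\<^sup>+x. G a \<sigma> (V x) \<partial>M)"
    by (simp add: UQ VP' flip: w_def)
qed

section \<open>Minimizers and weak solutions\<close>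

lemma F_finite_iff: "F a \<sigma> \<Omega> f v < \<infinity> \<longleftrightarrow> (\<integral>\<^sup>+x. G a \<sigma> (grad v x) \<partial>lebesgue_on \<Omega>) < \<infinity>"
  unfolding F_def by (cases "\<integral>\<^sup>+x. G a \<sigma> (grad v x) \<partial>lebesgue_on \<Omega>") (auto simp: less_top[symmetric])

lemma F_eq_ereal:
  assumes "F a \<sigma> \<Omega> f v < \<infinity>"
  shows "F a \<sigma> \<Omega> f v =
    ereal (enn2real (\<integral>\<^sup>+x. G a \<sigma> (grad v x) \<partial>lebesgue_on \<Omega>) - (\<integral>x. f x * v x \<partial>lebesgue_on \<Omega>))"
  using assms unfolding F_finite_iff
  by (cases "\<integral>\<^sup>+x. G a \<sigma> (grad v x) \<partial>lebesgue_on \<Omega>") (auto simp: F_def)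

text \<open>Testing with \<open>v - u\<close> identifies the first-order term of the integrated
  gradient inequality with the difference of the linear terms of \<open>F\<close>. Competitors of
  infinite energy are trivial.\<close>

lemma weak_solution_imp_minimizer:
  fixes \<Omega> :: "'a::euclidean_space set"
  assumes \<Omega>: "open \<Omega>" "bounded \<Omega>" and a: "\<And>p. p \<ge> 2 \<Longrightarrow> a p \<ge> 0"
    and f: "integrable (lebesgue_on \<Omega>) f"
    and u: "weak_solution a \<sigma> \<Omega> f g u"
    and wd: "\<And>v. v \<in> S \<Omega> \<sigma> g \<Longrightarrow> F a \<sigma> \<Omega> f v < \<infinity> \<Longrightarrow> flux_integral_well_defined a \<Omega> u (\<lambda>x. v x - u x)"
  shows "is_minimizer a \<sigma> \<Omega> f g u"
  unfolding is_minimizer_def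
proof (intro conjI ballI)
  show uS: "u \<in> S \<Omega> \<sigma> g" using u by (simp add: weak_solution_def)
  fix v assume vS: "v \<in> S \<Omega> \<sigma> g"
  show "F a \<sigma> \<Omega> f u \<le> F a \<sigma> \<Omega> f v"
  proof (cases "F a \<sigma> \<Omega> f v < \<infinity>")
    case True
    define \<psi> where "\<psi> x = v x - u x" for x
    have \<psi>_eq: "\<psi> = (\<lambda>x. v x + (-1) * u x)" by (simp add: \<psi>_def fun_eq_iff)
    note lu = mem_S_D(1)[OF uS] and lv = mem_S_D(1)[OF vS]
    have l\<psi>: "lipschitz_fun (closure \<Omega>) \<psi>" unfolding \<psi>_eq by (rule lipschitz_fun_add_scaled[OF lv lu])
    have \<psi>W: "\<psi> \<in> W0_inf \<Omega>"
      using l\<psi> mem_S_D(3)[OF uS] mem_S_D(3)[OF vS] by (simp add: W0_inf_def \<psi>_def)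
    obtain Cu Cv C\<psi> where C: "Cu-lipschitz_on \<Omega> u" "Cv-lipschitz_on \<Omega> v" "C\<psi>-lipschitz_on \<Omega> \<psi>"
      using lu lv l\<psi> lipschitz_fun_closure by metis
    note [measurable] = C[THEN lipschitz_grad_measurable[OF \<Omega>(1)]]
    have grad_\<psi>: "AE x in lebesgue_on \<Omega>. grad \<psi> x = grad v x - grad u x"
      using lipschitz_AE_partially_differentiable[OF \<Omega>(1) C(1)] lipschitz_AE_partially_differentiable[OF \<Omega>(1) C(2)]
      by eventually_elim (simp add: \<psi>_eq grad_add_scaled[where r = "-1", simplified])
    have "flux_integral_well_defined a \<Omega> u \<psi>" using wd[OF vS True] by (simp add: \<psi>_def[abs_def])
    then have conv: "AE x in lebesgue_on \<Omega>. flux_converges a (grad u x)"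
      and int: "integrable (lebesgue_on \<Omega>) (\<lambda>x. flux a (grad u x) \<bullet> grad \<psi> x)"
      by (auto simp: flux_integral_well_defined_def)
    have int': "integrable (lebesgue_on \<Omega>) (\<lambda>x. flux a (grad u x) \<bullet> (grad v x - grad u x))"
      by (rule integrable_cong_AE_imp[OF int]) (use grad_\<psi> in \<open>auto elim: eventually_mono\<close>)
    have eq: "(\<integral>x. flux a (grad u x) \<bullet> grad \<psi> x \<partial>lebesgue_on \<Omega>)
        = (\<integral>x. flux a (grad u x) \<bullet> (grad v x - grad u x) \<partial>lebesgue_on \<Omega>)"
      by (rule integral_cong_AE) (use grad_\<psi> in \<open>auto elim: eventually_mono\<close>)
    \<comment> \<open>The first fact makes \<psi> an admissible test function in the weak
      formulation; the second turns the series there into the flux integral.\<close>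
    note series = flux_series_integral[where a=a, OF a C(1,3)[THEN lipschitz_grad_measurable[OF \<Omega>(1)]] conv int, folded pLaplace_form_def]
    have "(\<Sum>n. a (n + 2) * pLaplace_form (n + 2) \<Omega> u \<psi>) = (\<integral>x. f x * \<psi> x \<partial>lebesgue_on \<Omega>)"
      using u \<psi>W series(1) unfolding weak_solution_def by blast
    then have "(\<integral>x. flux a (grad u x) \<bullet> grad \<psi> x \<partial>lebesgue_on \<Omega>) = (\<integral>x. f x * \<psi> x \<partial>lebesgue_on \<Omega>)"
      using sums_unique[OF series(2)] by simp
    also have "\<dots> = (\<integral>x. f x * v x \<partial>lebesgue_on \<Omega>) - (\<integral>x. f x * u x \<partial>lebesgue_on \<Omega>)"
      unfolding \<psi>_def right_diff_distrib
      by (intro Bochner_Integration.integral_diff integrable_mult_lipschitz \<Omega> lu lv f)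
    finally have weak: "(\<integral>x. flux a (grad u x) \<bullet> (grad v x - grad u x) \<partial>lebesgue_on \<Omega>)
      = (\<integral>x. f x * v x \<partial>lebesgue_on \<Omega>) - (\<integral>x. f x * u x \<partial>lebesgue_on \<Omega>)" using eq by simp
    have fin: "(\<integral>\<^sup>+x. G a \<sigma> (grad v x) \<partial>lebesgue_on \<Omega>) < \<infinity>" using True unfolding F_finite_iff .
    note ineq = integral_G_gradient_inequality[where a=a, OF a C(1,2)[THEN lipschitz_grad_measurable[OF \<Omega>(1)]]
        mem_S_D(2)[OF uS] conv int' fin]
    have "F a \<sigma> \<Omega> f u < \<infinity>" using ineq(1) unfolding F_finite_iff .
    then show ?thesis using ineq(2) weak unfolding F_eq_ereal[OF True] by (subst F_eq_ereal) auto
  next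
    case False
    then have "F a \<sigma> \<Omega> f v = \<infinity>" by simp
    then show ?thesis by simp
  qed
qed

section \<open>The flux inside the ball of convergence\<close>

text \<open>By Cauchy-Hadamard the power series with coefficients \<open>a\<close> has radius of
  convergence \<sigma>; dividing by \<open>\<rho>\<^sup>2\<close> shifts the exponent.\<close>

lemma flux_coefficients_summable:
  assumes a: "\<And>p. p \<ge> 2 \<Longrightarrow> a p \<ge> (0::real)" and "\<sigma> > 0"
    and "limsup (\<lambda>p. ereal (root p (a p))) = ereal (1 / \<sigma>)"
    and \<rho>: "0 < \<rho>" "\<rho> < \<sigma>"
  shows "summable (\<lambda>n. a (n + 2) * \<rho> ^ n)"
proof -
  \<comment> \<open>The sign of \<open>a p\<close> is known from index 2 on only, which is enough
    for a limsup.\<close>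
  have "limsup (\<lambda>p. ereal (root p (norm (a p)))) = limsup (\<lambda>p. ereal (root p (a p)))"
    by (intro Limsup_eq) (use a in \<open>auto intro!: eventually_sequentiallyI[of 2]\<close>)
  then have "conv_radius a = ereal \<sigma>"
    using assms(2,3) by (simp add: conv_radius_def)
  then have "summable (\<lambda>n. norm (a n * \<rho> ^ n))"
    using \<rho> by (intro abs_summable_in_conv_radius) simp
  then have "summable (\<lambda>n. a n * \<rho> ^ n)" by (rule summable_norm_cancel)
  then have "summable (\<lambda>n. a (n + 2) * \<rho> ^ (n + 2))" by (subst summable_iff_shift)
  then have "summable (\<lambda>n. a (n + 2) * \<rho> ^ (n + 2) / \<rho>\<^sup>2)" by (rule summable_divide)
  moreover have "a (n + 2) * \<rho> ^ (n + 2) / \<rho>\<^sup>2 = a (n + 2) * \<rho> ^ n" for n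
    using \<rho> by (simp add: power2_eq_square)
  ultimately show ?thesis by (simp only:)
qed

text \<open>In the closed ball of radius \<rho> the flux is a scalar power series in the norm times
  \<xi>, dominated by the series at \<rho>.\<close>

lemma
  fixes \<xi> :: "'a::euclidean_space"
  assumes a: "\<And>p. p \<ge> 2 \<Longrightarrow> a p \<ge> 0" and sum: "summable (\<lambda>n. a (n + 2) * \<rho> ^ n)"
    and \<xi>: "norm \<xi> \<le> \<rho>"
  shows flux_converges_in_ball: "flux_converges a \<xi>"
    and flux_in_ball: "flux a \<xi> = (\<Sum>n. a (n + 2) * norm \<xi> ^ n) *\<^sub>R \<xi>"
    and norm_flux_in_ball: "norm (flux a \<xi>) \<le> (\<Sum>n. a (n + 2) * \<rho> ^ n) * \<rho>"
proof -
  have le: "a (n + 2) * norm \<xi> ^ n \<le> a (n + 2) * \<rho> ^ n" for n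
    using a \<xi> by (intro mult_left_mono power_mono) auto
  have nn: "0 \<le> a (n + 2) * norm \<xi> ^ n" for n using a by simp
  have s: "summable (\<lambda>n. a (n + 2) * norm \<xi> ^ n)"
    by (rule summable_comparison_test'[OF sum, of 0]) (use le nn in \<open>simp add: abs_of_nonneg\<close>)
  then have sums: "(\<lambda>n. a (n + 2) *\<^sub>R pflux (n + 2) \<xi>) sums ((\<Sum>n. a (n + 2) * norm \<xi> ^ n) *\<^sub>R \<xi>)"
    unfolding scaleR_pflux by (intro bounded_linear.sums[OF bounded_linear_scaleR_left] summable_sums)
  then show "flux_converges a \<xi>" by (auto simp: flux_converges_def sums_iff)
  show eq: "flux a \<xi> = (\<Sum>n. a (n + 2) * norm \<xi> ^ n) *\<^sub>R \<xi>"
    using sums by (simp add: flux_def sums_iff)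
  have "norm (flux a \<xi>) = (\<Sum>n. a (n + 2) * norm \<xi> ^ n) * norm \<xi>"
    unfolding eq using suminf_nonneg[OF s nn] by simp
  also have "\<dots> \<le> (\<Sum>n. a (n + 2) * \<rho> ^ n) * \<rho>"
    using suminf_le[OF le s sum] suminf_nonneg[OF s nn] \<xi> by (intro mult_mono) auto
  finally show "norm (flux a \<xi>) \<le> (\<Sum>n. a (n + 2) * \<rho> ^ n) * \<rho>" .
qed

text \<open>A power series is continuous inside its disc of convergence. The sequential form fits
  dominated convergence, and the bound on all \<open>X k\<close> makes the closed formula valid for
  each term.\<close>

lemma tendsto_flux:
  fixes \<xi> :: "'a::euclidean_space"
  assumes a: "\<And>p. p \<ge> 2 \<Longrightarrow> a p \<ge> 0" and sum: "summable (\<lambda>n. a (n + 2) * \<rho> ^ n)"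
    and \<xi>: "norm \<xi> < \<rho>" and X: "X \<longlonglongrightarrow> \<xi>" and bound: "\<And>k. norm (X k) \<le> \<rho>"
  shows "(\<lambda>k. flux a (X k)) \<longlonglongrightarrow> flux a \<xi>"
proof -
  have "isCont (\<lambda>t. \<Sum>n. a (n + 2) * t ^ n) (norm \<xi>)"
    by (rule isCont_powser[OF sum]) (use \<xi> in auto)
  then have "(\<lambda>k. (\<Sum>n. a (n + 2) * norm (X k) ^ n) *\<^sub>R X k) \<longlonglongrightarrow> (\<Sum>n. a (n + 2) * norm \<xi> ^ n) *\<^sub>R \<xi>"
    by (intro tendsto_scaleR X isCont_tendsto_compose[where g = "\<lambda>t. \<Sum>n. a (n + 2) * t ^ n"] tendsto_norm)
  then show ?thesis
    using \<xi> by (simp add: flux_in_ball[where a = a, OF a sum bound] flux_in_ball[where a = a, OF a sum less_imp_le[OF \<xi>]])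
qed

text \<open>Linearizing the energy at the perturbed function bounds its growth from above by
  \<open>r * J r\<close>, while minimality bounds it from below by \<open>r\<close> times the
  integral of \<open>f * \<psi>\<close>. Thus \<open>F\<close> itself is never
  differentiated.\<close>

lemma minimizer_imp_weak_solution:
  fixes \<Omega> :: "'a::euclidean_space set"
  assumes \<Omega>: "open \<Omega>" "bounded \<Omega>" and a: "\<And>p. p \<ge> 2 \<Longrightarrow> a p \<ge> 0" and "\<sigma> > 0"
    and limsup: "limsup (\<lambda>p. ereal (root p (a p))) = ereal (1 / \<sigma>)"
    and f: "integrable (lebesgue_on \<Omega>) f"
    and finite_energy: "\<exists>h\<in>S \<Omega> \<sigma> g. F a \<sigma> \<Omega> f h < \<infinity>"
    and u: "is_minimizer a \<sigma> \<Omega> f g u" and strict: "Linf_norm \<Omega> (grad u) < ereal \<sigma>"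
  shows "weak_solution a \<sigma> \<Omega> f g u"
proof -
  let ?M = "lebesgue_on \<Omega>"
  interpret M: finite_measure ?M using \<Omega> by (rule lebesgue_on_bounded_open)
  have uS: "u \<in> S \<Omega> \<sigma> g" using u by (simp add: is_minimizer_def)
  note lu = mem_S_D(1)[OF uS]
  obtain Cu where Cu: "Cu-lipschitz_on \<Omega> u" using lu by (rule lipschitz_fun_closure)
  note [measurable] = lipschitz_grad_measurable[OF \<Omega>(1) Cu]
  have Fu: "F a \<sigma> \<Omega> f u < \<infinity>" using finite_energy u unfolding is_minimizer_def by (meson le_less_trans)
  obtain z where z: "Linf_norm \<Omega> (grad u) < ereal z" "z < \<sigma>" using ereal_dense2[OF strict] by auto
  \<comment> \<open>The intermediate value \<open>z\<close> carries no sign; the maximum keeps the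
    radius nonnegative.\<close>
  define \<tau> where "\<tau> = max 0 z"
  have "AE x in ?M. ereal (norm (grad u x)) \<le> Linf_norm \<Omega> (grad u)"
    unfolding Linf_norm_def by (rule esssup_AE)
  then have \<tau>_bound: "AE x in ?M. norm (grad u x) \<le> \<tau>"
  proof eventually_elim
    case (elim x)
    then have "ereal (norm (grad u x)) < ereal z" using z(1) by (rule le_less_trans)
    then show ?case by (simp add: \<tau>_def)
  qed
  \<comment> \<open>The midpoint leaves room for perturbing the gradient while staying strictly
    inside the ball of convergence.\<close>
  define \<rho> where "\<rho> = (\<tau> + \<sigma>) / 2"
  have \<rho>: "\<tau> < \<rho>" "0 < \<rho>" "\<rho> < \<sigma>" "0 \<le> \<tau>" using z \<open>\<sigma> > 0\<close> by (auto simp: \<rho>_def \<tau>_def)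
  have sum: "summable (\<lambda>n. a (n + 2) * \<rho> ^ n)"
    using flux_coefficients_summable[where a = a, OF a \<open>\<sigma> > 0\<close> limsup] \<rho> by simp
  define B where "B = (\<Sum>n. a (n + 2) * \<rho> ^ n) * \<rho>"
  have "(\<Sum>n. a (n + 2) * pLaplace_form (n + 2) \<Omega> u \<psi>) = (\<integral>x. f x * \<psi> x \<partial>?M)"
    if \<psi>: "\<psi> \<in> W0_inf \<Omega>" for \<psi>
  proof -
    have l\<psi>: "lipschitz_fun (closure \<Omega>) \<psi>" using \<psi> by (simp add: W0_inf_def)
    obtain C where C: "C-lipschitz_on \<Omega> \<psi>" using l\<psi> by (rule lipschitz_fun_closure)
    define E where "E = grad \<psi>"
    have E_measurable [measurable]: "E \<in> borel_measurable ?M"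
      unfolding E_def by (rule lipschitz_grad_measurable[OF \<Omega>(1) C])
    \<comment> \<open>The summand 1 keeps \<open>K\<close> positive even for \<open>C = 0\<close>,
      as \<delta> is obtained by dividing by \<open>K\<close>.\<close>
    define K where "K = real DIM('a) * C + 1"
    have K: "K > 0" using C by (auto simp: K_def lipschitz_on_def intro!: add_nonneg_pos)
    have partially_differentiable: "AE x in ?M. partially_differentiable u x" "AE x in ?M. partially_differentiable \<psi> x"
      using lipschitz_AE_partially_differentiable[OF \<Omega>(1) Cu] lipschitz_AE_partially_differentiable[OF \<Omega>(1) C] by auto
    have E_bound: "AE x in ?M. norm (E x) \<le> K"
      using partially_differentiable(2) AE_space
    proof eventually_elim
      case (elim x)
      then show ?case using norm_grad_le_lipschitz[OF \<Omega>(1) C, of x]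
        by (simp add: E_def K_def space_restrict_space)
    qed
    \<comment> \<open>For \<open>\<bar>r\<bar> \<le> \<delta>\<close> the perturbed gradient has
      norm at most \<open>\<tau> + \<delta> * K = \<rho>\<close>.\<close>
    define \<delta> where "\<delta> = (\<rho> - \<tau>) / K"
    have \<delta>: "\<delta> > 0" "\<delta> * K = \<rho> - \<tau>" using K \<rho> by (auto simp: \<delta>_def)
    have U_bound: "AE x in ?M. norm (grad u x + r *\<^sub>R E x) \<le> \<rho>" if r: "\<bar>r\<bar> \<le> \<delta>" for r
      using \<tau>_bound E_bound
    proof eventually_elim
      case (elim x)
      have "\<bar>r\<bar> * norm (E x) \<le> \<delta> * K" using r elim \<delta> by (intro mult_mono) auto
      then show ?case using elim \<delta>(2) norm_triangle_ineq[of "grad u x" "r *\<^sub>R E x"] by simp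
    qed
    have flux_bound: "AE x in ?M. norm (flux a (grad u x + r *\<^sub>R E x) \<bullet> E x) \<le> B * K"
      if r: "\<bar>r\<bar> \<le> \<delta>" for r
      using U_bound[OF r] E_bound
    proof eventually_elim
      case (elim x)
      note n = norm_flux_in_ball[where a = a, OF a sum elim(1)]
      have "norm (flux a (grad u x + r *\<^sub>R E x) \<bullet> E x) \<le> norm (flux a (grad u x + r *\<^sub>R E x)) * norm (E x)"
        by (simp add: Cauchy_Schwarz_ineq2)
      also have "\<dots> \<le> B * K"
        using n order_trans[OF norm_ge_zero n] elim(2) by (intro mult_mono) (auto simp: B_def)
      finally show ?case .
    qed
    define J where "J r = (\<integral>x. flux a (grad u x + r *\<^sub>R E x) \<bullet> E x \<partial>?M)" for r
    have int_J: "integrable ?M (\<lambda>x. flux a (grad u x + r *\<^sub>R E x) \<bullet> E x)" if r: "\<bar>r\<bar> \<le> \<delta>" for r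
      by (rule M.integrable_const_bound[OF flux_bound[OF r]]) measurable
    \<comment> \<open>\<open>w\<close> is an admissible competitor because \<psi> vanishes on the
      boundary and its gradient stays within \<rho>. The factor \<open>r\<close> is kept, since its
      sign decides the direction of the inequality.\<close>
    have key: "r * (\<integral>x. f x * \<psi> x \<partial>?M) \<le> r * J r" if r: "\<bar>r\<bar> \<le> \<delta>" for r
    proof -
      define w where "w x = u x + r * \<psi> x" for x
      have w_eq: "w = (\<lambda>x. u x + r * \<psi> x)" by (simp add: w_def fun_eq_iff)
      have lw: "lipschitz_fun (closure \<Omega>) w" unfolding w_eq by (rule lipschitz_fun_add_scaled[OF lu l\<psi>])
      obtain Cw where Cw: "Cw-lipschitz_on \<Omega> w" using lw by (rule lipschitz_fun_closure)
      note meas_w [measurable] = lipschitz_grad_measurable[OF \<Omega>(1) Cw]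
      have grad_w: "AE x in ?M. grad w x = grad u x + r *\<^sub>R E x"
        using partially_differentiable by eventually_elim (simp add: w_eq E_def grad_add_scaled)
      then have w_bound: "AE x in ?M. norm (grad w x) \<le> \<rho>"
        using U_bound[OF r] by eventually_elim simp
      then have "AE x in ?M. ereal (norm (grad w x)) \<le> ereal \<sigma>"
        by eventually_elim (use \<rho> in auto)
      then have "Linf_norm \<Omega> (grad w) \<le> ereal \<sigma>"
        unfolding Linf_norm_def by (intro esssup_I) measurable
      moreover have "w x = g x" if "x \<in> frontier \<Omega>" for x
        using \<psi> mem_S_D(3)[OF uS that] that by (simp add: w_def W0_inf_def)
      ultimately have "w \<in> S \<Omega> \<sigma> g" using lw by (simp add: S_def)
      then have min: "F a \<sigma> \<Omega> f u \<le> F a \<sigma> \<Omega> f w" using u by (simp add: is_minimizer_def)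
      have conv: "AE x in ?M. flux_converges a (grad w x)"
        using w_bound by eventually_elim (rule flux_converges_in_ball[where a = a, OF a sum])
      have w_bound': "AE x in ?M. norm (grad w x) \<le> \<sigma>"
        using w_bound by eventually_elim (use \<rho> in simp)
      have AE_eq: "AE x in ?M. - r * (flux a (grad u x + r *\<^sub>R E x) \<bullet> E x) = flux a (grad w x) \<bullet> (grad u x - grad w x)"
        using grad_w by eventually_elim simp
      have int: "integrable ?M (\<lambda>x. flux a (grad w x) \<bullet> (grad u x - grad w x))"
        by (rule integrable_cong_AE_imp[OF integrable_mult_right[OF int_J[OF r], of "- r"]])
          (measurable, use AE_eq in \<open>auto elim: eventually_mono\<close>)
      have "(\<integral>x. flux a (grad w x) \<bullet> (grad u x - grad w x) \<partial>?M)
          = (\<integral>x. - r * (flux a (grad u x + r *\<^sub>R E x) \<bullet> E x) \<partial>?M)"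
        by (rule integral_cong_AE) (measurable, use AE_eq in \<open>auto elim: eventually_mono\<close>)
      also have "\<dots> = - r * J r" unfolding J_def by (rule integral_mult_right_zero)
      finally have flux_int: "(\<integral>x. flux a (grad w x) \<bullet> (grad u x - grad w x) \<partial>?M) = - r * J r" .
      \<comment> \<open>The base point is \<open>grad w\<close> and the comparison point is
        \<open>grad u\<close>; hence finite energy of \<open>u\<close> yields that of
        \<open>w\<close>.\<close>
      note ineq = integral_G_gradient_inequality[where a = a, OF a meas_w lipschitz_grad_measurable[OF \<Omega>(1) Cu]
          w_bound' conv int Fu[unfolded F_finite_iff]]
      have Fw: "F a \<sigma> \<Omega> f w < \<infinity>" using ineq(1) unfolding F_finite_iff .
      have "(\<integral>x. f x * w x \<partial>?M) = (\<integral>x. f x * u x + r * (f x * \<psi> x) \<partial>?M)"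
        by (simp add: w_def algebra_simps)
      also have "\<dots> = (\<integral>x. f x * u x \<partial>?M) + r * (\<integral>x. f x * \<psi> x \<partial>?M)"
        using integrable_mult_lipschitz[OF \<Omega> lu f] integrable_mult_lipschitz[OF \<Omega> l\<psi> f] by simp
      finally show ?thesis
        using min ineq(2) unfolding F_eq_ereal[OF Fu] F_eq_ereal[OF Fw] flux_int by simp
    qed
    have J_lim: "(\<lambda>k. J (R k)) \<longlonglongrightarrow> J 0" if R: "R \<longlonglongrightarrow> 0" "\<And>k. \<bar>R k\<bar> \<le> \<delta>" for R
      unfolding J_def
    proof (rule integral_dominated_convergence[where w = "\<lambda>_. B * K"])
      \<comment> \<open>Countably many exceptional null sets are united, so that the bound holds
        along the whole sequence at almost every point.\<close>
      have "AE x in ?M. \<forall>k. norm (grad u x + R k *\<^sub>R E x) \<le> \<rho>"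
        using U_bound[OF R(2)] by (simp add: AE_all_countable)
      then show "AE x in ?M. (\<lambda>k. flux a (grad u x + R k *\<^sub>R E x) \<bullet> E x) \<longlonglongrightarrow> flux a (grad u x + 0 *\<^sub>R E x) \<bullet> E x"
        using \<tau>_bound
      proof eventually_elim
        case (elim x)
        have "(\<lambda>k. grad u x + R k *\<^sub>R E x) \<longlonglongrightarrow> grad u x + 0 *\<^sub>R E x"
          by (intro tendsto_intros R)
        then show ?case
          using elim \<rho> by (intro tendsto_inner tendsto_const tendsto_flux[where a = a, OF a sum]) auto
      qed
      show "AE x in ?M. norm (flux a (grad u x + R k *\<^sub>R E x) \<bullet> E x) \<le> B * K" for k
        by (rule flux_bound[OF R(2)])
    qed auto
    \<comment> \<open>A positive null sequence within the admissible range. Dividing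
      \<open>key\<close> by \<open>R k\<close> and by \<open>- R k\<close> gives the two opposite
      inequalities.\<close>
    define R where "R k = \<delta> * inverse (real (Suc k))" for k
    have R: "R \<longlonglongrightarrow> 0" "\<And>k. 0 < R k" "\<And>k. R k \<le> \<delta>"
    proof -
      show "R \<longlonglongrightarrow> 0" unfolding R_def using tendsto_mult_right_zero[OF LIMSEQ_inverse_real_of_nat] by simp
      show "0 < R k" for k using \<delta> by (simp add: R_def)
      have "inverse (real (Suc k)) \<le> 1" for k by (simp add: field_simps)
      then show "R k \<le> \<delta>" for k using \<delta> mult_left_le[of "inverse (real (Suc k))" \<delta>] by (simp add: R_def)
    qed
    have "(\<integral>x. f x * \<psi> x \<partial>?M) \<le> J (R k)" for k
      using key[of "R k"] R(2,3)[of k] by simp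
    then have "(\<integral>x. f x * \<psi> x \<partial>?M) \<le> J 0"
      using R by (intro LIMSEQ_le_const[OF J_lim[of R]]) (auto simp: abs_of_pos)
    moreover have "J (- R k) \<le> (\<integral>x. f x * \<psi> x \<partial>?M)" for k
      using key[of "- R k"] R(2,3)[of k] by simp
    then have "J 0 \<le> (\<integral>x. f x * \<psi> x \<partial>?M)"
      using R tendsto_minus[OF R(1)] by (intro LIMSEQ_le_const2[OF J_lim[of "\<lambda>k. - R k"]]) (auto simp: abs_of_pos)
    ultimately have J0: "J 0 = (\<integral>x. f x * \<psi> x \<partial>?M)" by simp
    have conv: "AE x in ?M. flux_converges a (grad u x)"
      using \<tau>_bound by eventually_elim (rule flux_converges_in_ball[where a = a, OF a sum], use \<rho> in auto)
    have int: "integrable ?M (\<lambda>x. flux a (grad u x) \<bullet> E x)" using int_J[of 0] \<delta> by simp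
    have "(\<lambda>n. a (n + 2) * pLaplace_form (n + 2) \<Omega> u \<psi>) sums (\<integral>x. flux a (grad u x) \<bullet> E x \<partial>?M)"
      using flux_series_integral(2)[where a = a, OF a lipschitz_grad_measurable[OF \<Omega>(1) Cu] E_measurable conv int]
      by (simp add: pLaplace_form_def E_def)
    then show ?thesis using J0 by (simp add: J_def sums_iff)
  qed
  then show ?thesis using uS by (simp add: weak_solution_def)
qed

theorem corollary3p8:
  fixes \<Omega> :: "'a::euclidean_space set"
    and a :: "nat \<Rightarrow> real" and \<sigma> :: real
    and f g :: "'a \<Rightarrow> real"
  assumes "open \<Omega>" and "connected \<Omega>" and "bounded \<Omega>" and "lipschitz_boundary \<Omega>"
    and "\<And>p. p \<ge> 2 \<Longrightarrow> a p \<ge> 0" and "a 2 > 0" and "infinite {p. p \<ge> 2 \<and> a p \<noteq> 0}"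
    and "\<sigma> > 0" and "limsup (\<lambda>p. ereal (root p (a p))) = ereal (1 / \<sigma>)"
    and "integrable (lebesgue_on \<Omega>) f"
    and "lipschitz_fun (frontier \<Omega>) g" and "lip_seminorm (frontier \<Omega>) g \<le> \<sigma>"
    and "\<exists>h\<in>S \<Omega> \<sigma> g. F a \<sigma> \<Omega> f h < \<infinity>"
  shows "(\<forall>u. is_minimizer a \<sigma> \<Omega> f g u \<and> Linf_norm \<Omega> (grad u) < ereal \<sigma> \<longrightarrow>
              weak_solution a \<sigma> \<Omega> f g u) \<and>
         (\<forall>u. weak_solution a \<sigma> \<Omega> f g u \<and>
              (\<forall>v\<in>S \<Omega> \<sigma> g. F a \<sigma> \<Omega> f v < \<infinity> \<longrightarrow>
                 flux_integral_well_defined a \<Omega> u (\<lambda>x. v x - u x)) \<longrightarrow>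
              is_minimizer a \<sigma> \<Omega> f g u)"
  using minimizer_imp_weak_solution[where a = a, OF assms(1,3,5,8,9,10,13)]
    weak_solution_imp_minimizer[where a = a, OF assms(1,3,5,10)]
  by blast

end
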